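(* Let $\mathcal{H}$ be a complex Hilbert space and let $T:\mathbb{Z}_4\to\mathcal{B}(\mathcal{H})$ be a map satisfying $T(0)=I_{\mathcal{H}}$, $T(1)=T_1=T(3)^*$ and $T(2)=T_2=T(2)^*$. Then the following are equivalent. (1) $T$ is positive definite. (2) The block matrix $$\Delta_T=\begin{bmatrix} I_{\mathcal{H}} & T_1 & T_2 & T_1^*\\ T_1^* & I_{\mathcal{H}} & T_1 & T_2\\ T_2 & T_1^* & I_{\mathcal{H}} & T_1\\ T_1 & T_2 & T_1^* & I_{\mathcal{H}}\end{bmatrix}\ge 0 .$$ (3) $T_1$ is a contraction and there is a self-adjoint contraction $\Gamma=\begin{bmatrix}\Gamma_1&\Gamma_2\\ \Gamma_2^*&\Gamma_4\end{bmatrix}$ on $\mathcal{H}\oplus\mathcal{H}$ such that, with $S=(T_1)_{1/2}$, $$T_2=D_{S^*}\Gamma_1D_{S^*}+D_{S^*}\Gamma_2S^*+S\Gamma_2^*D_{S^*}+S\Gamma_4S^*=S^*\Gamma_1S+S^*\Gamma_2D_S+D_S\Gamma_2^*S+D_S\Gamma_4D_S$$ and $$T_1=S^*\Gamma_1D_{S^*}+S^*\Gamma_2S^*+D_S\Gamma_2^*D_{S^*}+D_S\Gamma_4S^* .$$ (4) $T_1$ is a contraction, $\pm T_2\le I_{\mathcal{H}}$, and there are contractions $\Gamma_+:\overline{(I_{\mathcal{H}}+T_2)\mathcal{H}}\to\overline{(I_{\mathcal{H}}+T_2)\mathcal{H}}$ and $\Gamma_-:\overline{(I_{\mathcal{H}}-T_2)\mathcal{H}}\to\overline{(I_{\mathcal{H}}-T_2)\mathcal{H}}$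 such that $$T_1+T_1^*=(I_{\mathcal{H}}+T_2)^{1/2}\,\Gamma_+\,(I_{\mathcal{H}}+T_2)^{1/2}\quad\text{and}\quad T_1-T_1^*=(I_{\mathcal{H}}-T_2)^{1/2}\,\Gamma_-\,(I_{\mathcal{H}}-T_2)^{1/2}.$$
   Context: $\mathcal{B}(\mathcal{H})$ is the algebra of bounded linear operators on $\mathcal{H}$; $A\ge 0$ means $\langle Ax,x\rangle\ge 0$ for all $x$; a contraction is an operator of norm at most one. For a contraction $B$, $D_B=(I-B^*B)^{1/2}$. If $C\in\mathcal{B}(\mathcal{H})$ is a contraction, then $\begin{bmatrix} I_{\mathcal{H}}&C\\ C^*&I_{\mathcal{H}}\end{bmatrix}$ is positive on $\mathcal{H}\oplus\mathcal{H}$ and its unique positive square root has the form $\begin{bmatrix} D_{B^*}&B\\ B^*&D_B\end{bmatrix}$ for a contraction $B$ (with $C=2BD_B$); this operator $B$ (the $(1,2)$ entry of the square root) is denoted $(C)_{1/2}$. For a group $G$, a map $T:G\to\mathcal{B}(\mathcal{H})$ is positive definite if $T(s^{-1})=T(s)^*$ for every $s\in G$ and $\sum_{s\in G}\sum_{t\in G}\langle T(t^{-1}s)h(s),h(t)\rangle\ge 0$ for every finitely supported function $h:G\to\mathcal{H}$. $\mathbb{Z}_4=\{0,1,2,3\}$ is the (additive) cyclic group of order 4. *)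

theory Defs
  imports "HOL-Analysis.Analysis" "HOL-Library.Numeral_Type"
begin

section \<open>Complex Hilbert spaces\<close>

text \<open>The complex structure is put on top of the real inner product space given by the real
  part of the complex inner product, so that norm, topology and completeness are those of the
  library. The complex inner product is linear in its first argument. The space may be trivial
  and need not be separable.\<close>

class complex_inner = real_inner +
  fixes scaleC :: "complex \<Rightarrow> 'a \<Rightarrow> 'a" (infixr \<open>*\<^sub>C\<close> 75)
    and cinner :: "'a \<Rightarrow> 'a \<Rightarrow> complex"
  assumes scaleC_add_right: "a *\<^sub>C (x + y) = a *\<^sub>C x + a *\<^sub>C y"
    and scaleC_add_left: "(a + b) *\<^sub>C x = a *\<^sub>C x + b *\<^sub>C x"
    and scaleC_scaleC: "a *\<^sub>C b *\<^sub>C x = (a * b) *\<^sub>C x"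
    and scaleR_scaleC: "r *\<^sub>R x = complex_of_real r *\<^sub>C x"
    and cinner_commute: "cinner x y = cnj (cinner y x)"
    and cinner_add_left: "cinner (x + y) z = cinner x z + cinner y z"
    and cinner_scaleC_left: "cinner (a *\<^sub>C x) y = a * cinner x y"
    and inner_eq_Re_cinner: "inner x y = Re (cinner x y)"

class chilbert_space = complex_inner + complete_space

lemma scaleC_one: "1 *\<^sub>C x = (x :: 'a :: complex_inner)"
  using scaleR_scaleC[of 1 x] by simp

lemma cinner_self_eq_norm: "cinner x x = complex_of_real ((norm x)\<^sup>2)"
  for x :: "'a :: complex_inner"
proof (rule complex_eqI)
  show "Re (cinner x x) = Re (complex_of_real ((norm x)\<^sup>2))"
    by (simp add: inner_eq_Re_cinner[symmetric] power2_norm_eq_inner)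
  have "Im (cinner x x) = - Im (cinner x x)"
    by (metis cinner_commute complex_cnj cnj.simps(2))
  then show "Im (cinner x x) = Im (complex_of_real ((norm x)\<^sup>2))" by simp
qed

instantiation complex :: chilbert_space
begin

definition scaleC_complex :: "complex \<Rightarrow> complex \<Rightarrow> complex"
  where "scaleC_complex a x = a * x"

definition cinner_complex :: "complex \<Rightarrow> complex \<Rightarrow> complex"
  where "cinner_complex x y = x * cnj y"

instance
  by standard
    (simp_all add: scaleC_complex_def cinner_complex_def algebra_simps scaleR_conv_of_real
      inner_complex_def)

end

text \<open>The Hilbert space direct sum.\<close>

instantiation prod :: (complex_inner, complex_inner) complex_inner
begin

definition scaleC_prod :: "complex \<Rightarrow> 'a \<times> 'b \<Rightarrow> 'a \<times> 'b"
  where "scaleC_prod a x = (a *\<^sub>C fst x, a *\<^sub>C snd x)"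

definition cinner_prod :: "'a \<times> 'b \<Rightarrow> 'a \<times> 'b \<Rightarrow> complex"
  where "cinner_prod x y = cinner (fst x) (fst y) + cinner (snd x) (snd y)"

instance
proof
  fix x y :: "'a \<times> 'b"
  show "cinner x y = cnj (cinner y x)"
    using cinner_commute[of "fst x" "fst y"] cinner_commute[of "snd x" "snd y"]
    by (simp add: cinner_prod_def)
qed (simp_all add: scaleC_prod_def cinner_prod_def scaleC_add_right scaleC_add_left
      scaleC_scaleC scaleR_scaleC cinner_add_left cinner_scaleC_left inner_eq_Re_cinner
      inner_prod_def scaleR_prod_def algebra_simps)

end

instance prod :: (chilbert_space, chilbert_space) chilbert_space ..


section \<open>Bounded operators\<close>

definition bounded_clinear :: "('a::complex_inner \<Rightarrow> 'b::complex_inner) \<Rightarrow> bool"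
  where "bounded_clinear A \<longleftrightarrow> bounded_linear A \<and> (\<forall>c x. A (c *\<^sub>C x) = c *\<^sub>C A x)"

text \<open>For a bounded operator between Hilbert spaces the adjoint exists and is unique; for other
  maps the value is irrelevant.\<close>

definition cadjoint :: "('a::complex_inner \<Rightarrow> 'b::complex_inner) \<Rightarrow> 'b \<Rightarrow> 'a"
  where "cadjoint A = (THE B. \<forall>x y. cinner (A x) y = cinner x (B y))"

lemma cadjoint_eqI:
  assumes "\<And>x y. cinner (A x) y = cinner x (B y)"
  shows "cadjoint A = B"
  unfolding cadjoint_def
proof (rule the_equality)
  fix B' assume B': "\<forall>x y. cinner (A x) y = cinner x (B' y)"
  have "inner x (B' y) = inner x (B y)" for x y
    using assms B' by (simp add: inner_eq_Re_cinner)
  then show "B' = B" by (metis ext vector_eq_ldot)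
qed (use assms in blast)

definition positive_op :: "('a::complex_inner \<Rightarrow> 'a) \<Rightarrow> bool"
  where "positive_op A \<longleftrightarrow> bounded_clinear A \<and> (\<forall>x. cinner (A x) x \<in> \<real>\<^sub>\<ge>\<^sub>0)"

definition contraction :: "('a::complex_inner \<Rightarrow> 'b::complex_inner) \<Rightarrow> bool"
  where "contraction A \<longleftrightarrow> bounded_clinear A \<and> onorm A \<le> 1"

text \<open>A contraction from a linear subspace \<open>M\<close> into itself, represented by a total function
  whose values outside \<open>M\<close> are irrelevant.\<close>

definition contraction_on :: "'a::complex_inner set \<Rightarrow> ('a \<Rightarrow> 'a) \<Rightarrow> bool"
  where "contraction_on M A \<longleftrightarrow>
    (\<forall>x\<in>M. A x \<in> M) \<and>
    (\<forall>x\<in>M. \<forall>y\<in>M. A (x + y) = A x + A y) \<and>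
    (\<forall>c. \<forall>x\<in>M. A (c *\<^sub>C x) = c *\<^sub>C A x) \<and>
    (\<forall>x\<in>M. norm (A x) \<le> norm x)"

lemma contraction_on_UNIV: "contraction_on UNIV A \<longleftrightarrow> contraction A"
proof
  assume A: "contraction_on UNIV A"
  have "bounded_linear A"
    using A by (intro bounded_linear_intro[where K = 1])
      (auto simp: contraction_on_def scaleR_scaleC)
  moreover have "onorm A \<le> 1"
    using A by (intro onorm_bound) (auto simp: contraction_on_def)
  ultimately show "contraction A"
    using A by (auto simp: contraction_def bounded_clinear_def contraction_on_def)
next
  assume A: "contraction A"
  then have lin: "bounded_linear A" and le: "onorm A \<le> 1"
    by (auto simp: contraction_def bounded_clinear_def)
  have "norm (A x) \<le> norm x" for x
  proof -
    have "norm (A x) \<le> onorm A * norm x" by (rule onorm[OF lin])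
    also have "\<dots> \<le> norm x" using mult_right_mono[OF le norm_ge_zero[of x]] by simp
    finally show ?thesis .
  qed
  then show "contraction_on UNIV A"
    using A lin
    by (auto simp: contraction_def bounded_clinear_def contraction_on_def
        linear_add bounded_linear.linear)
qed

text \<open>The unique positive square root of a positive operator on a Hilbert space.\<close>

definition op_sqrt :: "('a::complex_inner \<Rightarrow> 'a) \<Rightarrow> 'a \<Rightarrow> 'a"
  where "op_sqrt A = (THE R. positive_op R \<and> R \<circ> R = A)"

text \<open>\<open>defect B\<close> is $D_B = (I - B^*B)^{1/2}$; accordingly \<open>defect (cadjoint B)\<close> is $D_{B^*}$.\<close>

definition defect :: "('a::complex_inner \<Rightarrow> 'b::complex_inner) \<Rightarrow> 'a \<Rightarrow> 'a"
  where "defect B = op_sqrt (\<lambda>x. x - cadjoint B (B x))"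

definition block_op ::
  "('a \<Rightarrow> 'a) \<Rightarrow> ('a \<Rightarrow> 'a) \<Rightarrow> ('a \<Rightarrow> 'a) \<Rightarrow> ('a \<Rightarrow> 'a) \<Rightarrow> 'a \<times> 'a \<Rightarrow> 'a \<times> ('a::complex_inner)"
  where "block_op A B C D = (\<lambda>(x, y). (A x + B y, C x + D y))"

text \<open>\<open>half_op C\<close> is $(C)_{1/2}$, the $(1,2)$ entry of the positive square root of the
  $2 \times 2$ block operator with rows $(I, C)$ and $(C^*, I)$.\<close>

definition half_op :: "('a::complex_inner \<Rightarrow> 'a) \<Rightarrow> 'a \<Rightarrow> 'a"
  where "half_op C = (\<lambda>x. fst (op_sqrt (block_op id C (cadjoint C) id) (0, x)))"


section \<open>Positive definite maps on groups\<close>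

text \<open>The group is written additively but not assumed commutative. The double sum over the group
  is the sum over the support of \<open>h\<close>, as \<open>T\<close> takes values in the bounded operators.\<close>

definition positive_definite :: "('g::group_add \<Rightarrow> 'a::complex_inner \<Rightarrow> 'a) \<Rightarrow> bool"
  where "positive_definite T \<longleftrightarrow>
    (\<forall>s. T (- s) = cadjoint (T s)) \<and>
    (\<forall>h. finite {s. h s \<noteq> 0} \<longrightarrow>
      (\<Sum>s | h s \<noteq> 0. \<Sum>t | h t \<noteq> 0. cinner (T (- t + s) (h s)) (h t)) \<in> \<real>\<^sub>\<ge>\<^sub>0)"

text \<open>The type \<open>4\<close> is the ring of integers modulo 4, used here as an additive group. The
  operator $\Delta_T$ acts on the fourfold direct sum, encoded as a nested pair.\<close>

definition Delta_op ::
  "(4 \<Rightarrow> 'a \<Rightarrow> 'a) \<Rightarrow> 'a \<times> 'a \<times> 'a \<times> 'a \<Rightarrow> 'a \<times> 'a \<times> 'a \<times> ('a::complex_inner)"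
  where "Delta_op T = (\<lambda>(x0, x1, x2, x3).
    (x0                   + T 1 x1            + T 2 x2            + cadjoint (T 1) x3,
     cadjoint (T 1) x0    + x1                + T 1 x2            + T 2 x3,
     T 2 x0               + cadjoint (T 1) x1 + x2                + T 1 x3,
     T 1 x0               + T 2 x1            + cadjoint (T 1) x2 + x3))"

end

theory Submission
  imports Defs
begin

text \<open>Positive definiteness is nonnegativity of the quadratic form of \<open>\<Delta>\<close>. Grouping the
  coordinates as \<open>(0, 1)\<close> and \<open>(2, 3)\<close> turns \<open>\<Delta>\<close> into the block operator with rows
  \<open>(M, B)\<close> and \<open>(B, M)\<close>, where \<open>M\<close> has rows \<open>(I, T\<^sub>1)\<close>, \<open>(T\<^sub>1\<^sup>*, I)\<close> and \<open>B\<close> is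
  self-adjoint; it is positive iff \<open>M \<ge> 0\<close> and \<open>B = M\<^sup>1\<^sup>/\<^sup>2 \<Gamma> M\<^sup>1\<^sup>/\<^sup>2\<close> for a self-adjoint contraction
  \<open>\<Gamma>\<close>, and the entries of this identity are the equations of (3). Splitting vectors into the even and odd
  parts for the shift by 2 instead decouples \<open>\<Delta>\<close> into the two block operators with diagonal
  \<open>I \<plusminus> T\<^sub>2\<close> and off-diagonal entry \<open>T\<^sub>1 \<plusminus> T\<^sub>1\<^sup>*\<close>, which gives (4) by the same factorization.
  Adjoints, square roots and factorizations are constructed for the underlying real inner product.\<close>

section \<open>Minimizing sequences and positive semidefinite operators\<close>

text \<open>For \<open>a > 0\<close> evaluate at the minimizer \<open>- b / a\<close>; for
  \<open>a = 0\<close> an affine function bounded below has zero slope. With \<open>c = 0\<close>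
  the conclusion forces \<open>b = 0\<close>, which is how a first variation is exploited
  below.\<close>

lemma discriminant_le:
  fixes a b c :: real
  assumes "0 \<le> a" and "\<And>t. 0 \<le> a * t\<^sup>2 + 2 * b * t + c"
  shows "b\<^sup>2 \<le> a * c"
proof (cases "a = 0")
  case True
  have "b = 0"
  proof (rule ccontr)
    assume "b \<noteq> 0"
    then have "2 * b * (- (c + 1) / (2 * b)) + c = - 1" by (simp add: field_simps)
    moreover have "0 \<le> 2 * b * (- (c + 1) / (2 * b)) + c"
      using assms(2)[of "- (c + 1) / (2 * b)"] unfolding True mult_zero_left add_0_left .
    ultimately show False by linarith
  qed
  with True show ?thesis by simp
next
  case False
  with assms(1) show ?thesis
    using assms(2)[of "- b / a"] by (simp add: field_simps power2_eq_square)
qed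

text \<open>A common source of adjoints (\<open>L = id\<close>), orthogonal projections and
  factorizations: \<open>z\<close> is the limit of \<open>L x\<close> along a minimizing sequence of
  \<open>\<parallel>L x\<parallel>\<^sup>2 - 2 g x\<close>.\<close>

lemma Riesz_range:
  fixes L :: "'a::real_vector \<Rightarrow> 'b::{real_inner,complete_space}"
  assumes L: "linear L" and g: "linear g" and c: "0 \<le> c"
    and bound: "\<And>x. g x \<le> c * norm (L x)"
  obtains z where "z \<in> closure (range L)" "norm z \<le> c" "\<And>x. inner (L x) z = g x"
proof -
  interpret L: linear L by fact
  interpret g: linear g by fact
  define f where "f x = (norm (L x))\<^sup>2 - 2 * g x" for x
  define m where "m = Inf (range f)"
  have f_ge: "- c\<^sup>2 \<le> f x" for x
  proof -
    have "0 \<le> (norm (L x) - c)\<^sup>2" by simp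
    with bound[of x] show ?thesis
      unfolding f_def by (simp add: power2_diff algebra_simps)
  qed
  then have bdd: "bdd_below (range f)" by (intro bdd_belowI[of _ "- c\<^sup>2"]) auto
  then have m_le: "m \<le> f x" for x unfolding m_def by (intro cInf_lower) auto
  have "\<exists>x. f x < m + 1 / Suc n" for n
    using cInf_lessD[of "range f" "m + 1 / Suc n"] unfolding m_def by auto
  then obtain X where X: "\<And>n. f (X n) < m + 1 / Suc n" by metis
  \<comment> \<open>Parallelogram law for \<open>L x\<close> and \<open>L y\<close>; the linear
    terms in \<open>g\<close> cancel. As the value at the midpoint is at least \<open>m\<close>,
    near-minimizers have nearby images under \<open>L\<close>.\<close>
  have par: "(norm (L x - L y))\<^sup>2 = 2 * f x + 2 * f y - 4 * f ((1/2) *\<^sub>R (x + y))" for x y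
    unfolding f_def power2_norm_eq_inner L.add L.scaleR g.add g.scaleR
    by (simp add: inner_simps inner_commute algebra_simps)
  have close: "(norm (L (X i) - L (X j)))\<^sup>2 \<le> 2 / Suc i + 2 / Suc j" for i j
    using X[of i] X[of j] m_le[of "(1/2) *\<^sub>R (X i + X j)"] unfolding par by simp
  have "Cauchy (\<lambda>n. L (X n))"
  proof (rule metric_CauchyI)
    fix e :: real assume e: "0 < e"
    obtain N where N: "4 / e\<^sup>2 < real N" using reals_Archimedean2 by blast
    have "dist (L (X i)) (L (X j)) < e" if "i \<ge> N" "j \<ge> N" for i j
    proof -
      have "4 < e\<^sup>2 * N" using N e by (simp add: field_simps)
      then have N0: "0 < N" by (auto intro: gr0I)
      have "2 / Suc i \<le> 2 / real N" "2 / Suc j \<le> 2 / real N"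
        using that N0 by (auto intro!: divide_left_mono)
      moreover have "4 / N < e\<^sup>2" using N0 \<open>4 < e\<^sup>2 * N\<close> by (simp add: field_simps)
      ultimately have "(norm (L (X i) - L (X j)))\<^sup>2 < e\<^sup>2" using close[of i j] by simp
      then show ?thesis unfolding dist_norm using e by (simp add: power2_less_imp_less)
    qed
    then show "\<exists>M. \<forall>i\<ge>M. \<forall>j\<ge>M. dist (L (X i)) (L (X j)) < e" by blast
  qed
  then obtain z where z: "(\<lambda>n. L (X n)) \<longlonglongrightarrow> z" using Cauchy_convergent_iff convergent_def by blast
  have eq: "inner (L x) z = g x" for x
  proof -
    \<comment> \<open>First variation: perturbing \<open>X n\<close> by \<open>t *\<^sub>R x\<close>
      lowers \<open>f\<close> by less than \<open>1 / Suc n\<close>. In the limit the quadratic in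
      \<open>t\<close> has constant term 0, so its linear coefficient vanishes.\<close>
    have "0 \<le> (norm (L x))\<^sup>2 * t\<^sup>2 + 2 * (inner z (L x) - g x) * t + 0" for t
    proof (rule LIMSEQ_le_const)
      show "(\<lambda>n. (norm (L x))\<^sup>2 * t\<^sup>2 + 2 * (inner (L (X n)) (L x) - g x) * t + 1 / real (Suc n))
          \<longlonglongrightarrow> (norm (L x))\<^sup>2 * t\<^sup>2 + 2 * (inner z (L x) - g x) * t + 0"
        by (intro tendsto_intros z LIMSEQ_Suc[OF lim_1_over_n])
      have "0 \<le> (norm (L x))\<^sup>2 * t\<^sup>2 + 2 * (inner (L (X n)) (L x) - g x) * t + 1 / real (Suc n)" for n
        using X[of n] m_le[of "X n + t *\<^sub>R x"]
        unfolding f_def power2_norm_eq_inner L.add L.scaleR g.add g.scaleR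
        by (simp add: inner_simps inner_commute algebra_simps power2_eq_square)
      then show "\<exists>N. \<forall>n\<ge>N. 0 \<le> (norm (L x))\<^sup>2 * t\<^sup>2 + 2 * (inner (L (X n)) (L x) - g x) * t + 1 / real (Suc n)"
        by blast
    qed
    from discriminant_le[OF _ this] show ?thesis by (simp add: inner_commute)
  qed
  \<comment> \<open>Along the sequence \<open>inner (L (X n)) z = g (X n)\<close> is at most
    \<open>c * norm (L (X n))\<close>, and this estimate survives the limit.\<close>
  have "inner z z \<le> c * norm z"
  proof (rule LIMSEQ_le)
    show "(\<lambda>n. inner (L (X n)) z) \<longlonglongrightarrow> inner z z" by (intro tendsto_intros z)
    show "(\<lambda>n. c * norm (L (X n))) \<longlonglongrightarrow> c * norm z" by (intro tendsto_intros z)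
  qed (use eq bound in auto)
  then have "norm z \<le> c"
    using c by (cases "z = 0") (auto simp: power2_norm_eq_inner[symmetric] power2_eq_square)
  moreover have "z \<in> closure (range L)"
    using z by (auto simp: closure_sequential intro!: exI[of _ "\<lambda>n. L (X n)"])
  ultimately show ?thesis using eq that by blast
qed

text \<open>The vectors orthogonal to \<open>z - z'\<close> form a closed set containing the range,
  hence also \<open>z\<close> and \<open>z'\<close>; so \<open>z - z'\<close> is orthogonal to
  itself.\<close>

lemma closure_range_orthogonal_eq_0:
  fixes L :: "'a \<Rightarrow> 'b::real_inner"
  assumes "z \<in> closure (range L)" "z' \<in> closure (range L)"
    and "\<And>x. inner (L x) z = inner (L x) z'"
  shows "z = z'"
proof -
  have "closure (range L) \<subseteq> {w. inner w (z - z') = 0}"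
    by (rule closure_minimal)
      (use assms(3) in \<open>auto simp: inner_diff_right intro!: closed_Collect_eq continuous_intros\<close>)
  then have "inner z (z - z') = 0" "inner z' (z - z') = 0" using assms by auto
  then have "inner (z - z') (z - z') = 0" by (simp only: inner_diff_left)
  then show ?thesis by simp
qed

text \<open>A real quadratic form does not determine the antisymmetric part of its operator, so
  symmetry is demanded explicitly; for complex linear operators \<open>positive_op_iff_psd\<close>
  recovers it from positivity.\<close>

definition psd :: "('a::real_inner \<Rightarrow> 'a) \<Rightarrow> bool"
  where "psd A \<longleftrightarrow> bounded_linear A \<and> (\<forall>x y. inner (A x) y = inner x (A y)) \<and> (\<forall>x. 0 \<le> inner (A x) x)"

lemma psdD:
  assumes "psd A"
  shows psd_bounded_linear: "bounded_linear A" and psd_linear: "linear A"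
    and psd_selfadjoint: "inner (A x) y = inner x (A y)" and psd_nonneg: "0 \<le> inner (A x) x"
  using assms by (auto simp: psd_def bounded_linear.linear)

lemma psd_Cauchy_Schwarz:
  assumes "psd A"
  shows "(inner (A x) y)\<^sup>2 \<le> inner (A x) x * inner (A y) y"
proof -
  have "0 \<le> inner (A x) x * t\<^sup>2 + 2 * inner (A x) y * t + inner (A y) y" for t
  proof -
    have "A (t *\<^sub>R x + y) = t *\<^sub>R A x + A y"
      using psd_linear[OF assms] by (simp add: linear_add linear_scale)
    moreover have "inner (A y) x = inner (A x) y"
      by (metis assms inner_commute psd_selfadjoint)
    ultimately show ?thesis using psd_nonneg[OF assms, of "t *\<^sub>R x + y"]
      by (simp add: inner_simps algebra_simps power2_eq_square)
  qed
  then show ?thesis by (intro discriminant_le psd_nonneg assms)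
qed

lemma psd_eq_0:
  assumes "psd A" "inner (A x) x = 0"
  shows "A x = 0"
  using psd_Cauchy_Schwarz[OF assms(1), of x "A x"] assms(2) by simp

text \<open>Cauchy-Schwarz for the form of \<open>A\<close>, applied to \<open>x\<close> and
  \<open>A x\<close>, followed by cancelling one factor \<open>(norm (A x))\<^sup>2\<close>.\<close>

lemma psd_norm_le:
  assumes "psd A" "\<And>x. inner (A x) x \<le> (norm x)\<^sup>2"
  shows "norm (A x) \<le> norm x"
proof -
  have "((norm (A x))\<^sup>2)\<^sup>2 \<le> inner (A x) x * inner (A (A x)) (A x)"
    using psd_Cauchy_Schwarz[OF assms(1), of x "A x"] by (simp add: power2_norm_eq_inner)
  also have "\<dots> \<le> (norm x)\<^sup>2 * (norm (A x))\<^sup>2"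
    using assms by (intro mult_mono) (auto simp: psd_nonneg)
  finally have "(norm (A x))\<^sup>2 \<le> (norm x)\<^sup>2" if "A x \<noteq> 0"
    using that unfolding power2_eq_square[of "(norm (A x))\<^sup>2"]
    by (simp only: mult_le_cancel_right) simp
  then show ?thesis by (cases "A x = 0") (simp, blast intro: power2_le_imp_le norm_ge_zero)
qed

section \<open>Square roots\<close>

text \<open>With \<open>B = I - A\<close>, the fixed point \<open>X = (B + X\<^sup>2) / 2\<close> satisfies
  \<open>(I - X)\<^sup>2 = A\<close>. The same iteration for the scalar \<open>B = 1\<close> majorizes the operator
  iterates and their increments, so no monotone convergence of operators is needed.\<close>

primrec sqrt_iter :: "('a::real_vector \<Rightarrow> 'a) \<Rightarrow> nat \<Rightarrow> 'a \<Rightarrow> 'a" where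
  "sqrt_iter B 0 = (\<lambda>x. 0)"
| "sqrt_iter B (Suc n) = (\<lambda>x. (1/2) *\<^sub>R (B x + sqrt_iter B n (sqrt_iter B n x)))"

primrec sqrt_majorant :: "nat \<Rightarrow> real" where
  "sqrt_majorant 0 = 0"
| "sqrt_majorant (Suc n) = (1 + (sqrt_majorant n)\<^sup>2) / 2"

lemma sqrt_majorant_bounds: "0 \<le> sqrt_majorant n" "sqrt_majorant n \<le> 1"
proof (induction n)
  case (Suc n)
  { case 2
    show ?case using Suc power_le_one[of "sqrt_majorant n" 2] by simp }
qed auto

lemma sqrt_majorant_mono: "sqrt_majorant n \<le> sqrt_majorant (Suc n)"
proof -
  have "0 \<le> (1 - sqrt_majorant n)\<^sup>2" by simp
  then show ?thesis by (simp add: power2_diff)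
qed

lemma linear_sqrt_iter: "linear B \<Longrightarrow> linear (sqrt_iter B n)"
  by (induction n) (auto simp: linear_iff algebra_simps)

lemma sqrt_iter_norm_le:
  assumes "linear B" "\<And>x. norm (B x) \<le> norm x"
  shows "norm (sqrt_iter B n x) \<le> sqrt_majorant n * norm x"
proof (induction n arbitrary: x)
  case (Suc n)
  have "norm (sqrt_iter B (Suc n) x) \<le> (norm (B x) + norm (sqrt_iter B n (sqrt_iter B n x))) / 2"
    by (simp add: norm_triangle_ineq)
  also have "norm (sqrt_iter B n (sqrt_iter B n x)) \<le> sqrt_majorant n * (sqrt_majorant n * norm x)"
    using Suc[of "sqrt_iter B n x"] mult_left_mono[OF Suc[of x] sqrt_majorant_bounds(1)[of n]]
    by linarith
  finally show ?case using assms(2)[of x] by (simp add: power2_eq_square algebra_simps)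
qed simp

text \<open>For consecutive iterates \<open>X\<close> and \<open>Y\<close>, the difference of
  squares splits as \<open>Y (Y - X) + (Y - X) X\<close> without any commutation. Estimating each
  term by the scalars \<open>a\<close> and \<open>b\<close> gives
  \<open>b (b - a) + (b - a) a\<close>, the difference of the scalar squares.\<close>

lemma sqrt_iter_diff_le:
  assumes "linear B" "\<And>x. norm (B x) \<le> norm x"
  shows "norm (sqrt_iter B (Suc n) x - sqrt_iter B n x)
    \<le> (sqrt_majorant (Suc n) - sqrt_majorant n) * norm x"
proof (induction n arbitrary: x)
  case 0
  then show ?case using assms(2)[of x] by simp
next
  case (Suc n)
  define X where "X = sqrt_iter B n"
  define Y where "Y = sqrt_iter B (Suc n)"
  define a where "a = sqrt_majorant n"
  define b where "b = sqrt_majorant (Suc n)"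
  have IH: "norm (Y x - X x) \<le> (b - a) * norm x" for x
    using Suc unfolding X_def Y_def a_def b_def .
  have X: "norm (X x) \<le> a * norm x" and Y: "norm (Y x) \<le> b * norm x" for x
    using sqrt_iter_norm_le[OF assms] unfolding X_def Y_def a_def b_def by blast+
  have "linear Y" unfolding Y_def by (rule linear_sqrt_iter[OF assms(1)])
  have ab: "a \<le> b" "0 \<le> b"
    unfolding a_def b_def by (rule sqrt_majorant_mono sqrt_majorant_bounds)+
  have "norm (Y (Y x) - X (X x)) = norm (Y (Y x - X x) + (Y (X x) - X (X x)))"
    by (simp add: linear_diff[OF \<open>linear Y\<close>])
  also have "\<dots> \<le> norm (Y (Y x - X x)) + norm (Y (X x) - X (X x))"
    by (rule norm_triangle_ineq)
  also have "norm (Y (Y x - X x)) \<le> b * ((b - a) * norm x)"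
    using Y[of "Y x - X x"] mult_left_mono[OF IH[of x] ab(2)] by linarith
  also have "norm (Y (X x) - X (X x)) \<le> (b - a) * (a * norm x)"
    using IH[of "X x"] mult_left_mono[OF X[of x], of "b - a"] ab(1) by linarith
  finally have "norm (Y (Y x) - X (X x)) \<le> (b\<^sup>2 - a\<^sup>2) * norm x"
    by (simp add: power2_eq_square algebra_simps)
  moreover have "sqrt_iter B (Suc (Suc n)) x - sqrt_iter B (Suc n) x
      = (1/2) *\<^sub>R (Y (Y x) - X (X x))"
  proof -
    have "sqrt_iter B (Suc (Suc n)) x = (1/2) *\<^sub>R (B x + Y (Y x))"
      unfolding Y_def by (subst sqrt_iter.simps(2)) (rule refl)
    moreover have "sqrt_iter B (Suc n) x = (1/2) *\<^sub>R (B x + X (X x))"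
      unfolding X_def by simp
    ultimately show ?thesis by (simp only: scaleR_diff_right scaleR_add_right) simp
  qed
  moreover have "sqrt_majorant (Suc (Suc n)) - sqrt_majorant (Suc n) = (b\<^sup>2 - a\<^sup>2) / 2"
  proof -
    have "sqrt_majorant (Suc (Suc n)) = (1 + b\<^sup>2) / 2"
      unfolding b_def by (subst sqrt_majorant.simps(2)) (rule refl)
    moreover have "sqrt_majorant (Suc n) = (1 + a\<^sup>2) / 2"
      unfolding a_def by simp
    ultimately show ?thesis by (simp only: diff_divide_distrib[symmetric]) simp
  qed
  ultimately show ?case by (simp only: norm_scaleR)
qed

lemma sqrt_iter_diff_le':
  assumes "linear B" "\<And>x. norm (B x) \<le> norm x" "n \<le> m"
  shows "norm (sqrt_iter B m x - sqrt_iter B n x) \<le> (sqrt_majorant m - sqrt_majorant n) * norm x"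
  using assms(3)
proof (induction m rule: dec_induct)
  case (step k)
  have "norm (sqrt_iter B (Suc k) x - sqrt_iter B n x)
      \<le> norm (sqrt_iter B (Suc k) x - sqrt_iter B k x) + norm (sqrt_iter B k x - sqrt_iter B n x)"
    using norm_triangle_ineq[of "sqrt_iter B (Suc k) x - sqrt_iter B k x"
        "sqrt_iter B k x - sqrt_iter B n x"] by (simp del: sqrt_iter.simps)
  also have "\<dots> \<le> (sqrt_majorant (Suc k) - sqrt_majorant k) * norm x
      + (sqrt_majorant k - sqrt_majorant n) * norm x"
    by (intro add_mono sqrt_iter_diff_le assms step)
  also have "\<dots> = (sqrt_majorant (Suc k) - sqrt_majorant n) * norm x"
    by (simp del: sqrt_majorant.simps add: algebra_simps)
  finally show ?case .
qed simp

text \<open>The majorant is increasing and bounded, hence Cauchy, and its increments dominate those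
  of the iterates.\<close>

lemma sqrt_iter_convergent:
  fixes B :: "'a::{real_inner,complete_space} \<Rightarrow> 'a"
  assumes "linear B" "\<And>x. norm (B x) \<le> norm x"
  shows "convergent (\<lambda>n. sqrt_iter B n x)"
proof -
  have "incseq sqrt_majorant" by (intro incseq_SucI sqrt_majorant_mono)
  then obtain l where "sqrt_majorant \<longlonglongrightarrow> l"
    using incseq_convergent[of sqrt_majorant 1] sqrt_majorant_bounds(2) by blast
  then have "convergent sqrt_majorant" by (auto simp: convergent_def)
  then have a: "Cauchy sqrt_majorant" by (rule convergent_Cauchy)
  have "Cauchy (\<lambda>n. sqrt_iter B n x)"
  proof (rule CauchyI')
    fix e :: real assume "0 < e"
    \<comment> \<open>The summand 1 keeps the denominator positive when
      \<open>x = 0\<close>.\<close>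
    then have e: "0 < e / (norm x + 1)" by (simp add: add_nonneg_pos)
    obtain N where N: "\<And>m n. m \<ge> N \<Longrightarrow> n \<ge> N \<Longrightarrow>
        norm (sqrt_majorant m - sqrt_majorant n) < e / (norm x + 1)"
      using CauchyD[OF a e] by blast
    have "norm (sqrt_iter B m x - sqrt_iter B n x) < e" if "m \<ge> N" "m < n" for m n
    proof -
      have pos: "0 < norm x + 1" by (simp add: add_nonneg_pos)
      have "norm (sqrt_iter B n x - sqrt_iter B m x)
          \<le> (sqrt_majorant n - sqrt_majorant m) * norm x"
        by (rule sqrt_iter_diff_le'[OF assms]) (use that in simp)
      also have "\<dots> \<le> norm (sqrt_majorant n - sqrt_majorant m) * (norm x + 1)"
        by (intro mult_mono) auto
      also have "\<dots> < e" using N[of n m] that pos by (simp add: pos_less_divide_eq)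
      finally show ?thesis by (simp add: norm_minus_commute)
    qed
    then show "\<exists>M. \<forall>m\<ge>M. \<forall>n>m. dist (sqrt_iter B m x) (sqrt_iter B n x) < e"
      unfolding dist_norm by blast
  qed
  then show ?thesis by (simp add: Cauchy_convergent_iff)
qed

lemma sqrt_iter_selfadjoint:
  assumes "\<And>x y. inner (B x) y = inner x (B y)"
  shows "inner (sqrt_iter B n x) y = inner x (sqrt_iter B n y)"
  by (induction n arbitrary: x y) (simp_all add: inner_simps assms)

lemma sqrt_iter_commute:
  assumes "linear C" "\<And>x. C (B x) = B (C x)"
  shows "C (sqrt_iter B n x) = sqrt_iter B n (C x)"
  by (induction n arbitrary: x)
    (simp_all add: assms linear_0 linear_add linear_scale)

text \<open>The root is \<open>I - X\<close> for the limit \<open>X\<close> of the iteration; it is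
  positive because \<open>X\<close> is a contraction. The clause on commuting operators is used
  twice: for uniqueness of the root, and with \<open>C\<close> a complex scalar for its complex
  linearity.\<close>

lemma psd_contraction_sqrt_exists:
  fixes A :: "'a::{real_inner,complete_space} \<Rightarrow> 'a"
  assumes A: "psd A" and A_le: "\<And>x. inner (A x) x \<le> (norm x)\<^sup>2"
  shows "\<exists>R. psd R \<and> (\<forall>x. R (R x) = A x) \<and>
    (\<forall>C. bounded_linear C \<longrightarrow> (\<forall>x. C (A x) = A (C x)) \<longrightarrow> (\<forall>x. C (R x) = R (C x)))"
proof -
  define B where "B x = x - A x" for x
  have B: "psd B"
    using A A_le unfolding psd_def B_def[abs_def]
    by (auto simp: inner_simps power2_norm_eq_inner intro!: bounded_linear_intros)
  have B_le: "norm (B x) \<le> norm x" for x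
    by (rule psd_norm_le[OF B])
      (use psd_nonneg[OF A] in \<open>auto simp: B_def inner_simps power2_norm_eq_inner\<close>)
  have linB: "linear B" using psd_linear[OF B] .
  note X_le = sqrt_iter_norm_le[OF linB B_le]
  have X_le1: "norm (sqrt_iter B n x) \<le> norm x" for n x
    using X_le[of n x] mult_right_mono[OF sqrt_majorant_bounds(2)[of n] norm_ge_zero[of x]] by linarith
  define X where "X x = lim (\<lambda>n. sqrt_iter B n x)" for x
  have X: "(\<lambda>n. sqrt_iter B n x) \<longlonglongrightarrow> X x" for x
    unfolding X_def using sqrt_iter_convergent[OF linB B_le] by (simp add: convergent_LIMSEQ_iff)
  have X_norm: "norm (X x) \<le> norm x" for x
    by (rule Lim_norm_ubound[OF _ X]) (auto simp: X_le1)
  have X_add: "X (x + y) = X x + X y" for x y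
  proof (rule LIMSEQ_unique[OF X])
    show "(\<lambda>n. sqrt_iter B n (x + y)) \<longlonglongrightarrow> X x + X y"
      using tendsto_add[OF X[of x] X[of y]] by (simp add: linear_add[OF linear_sqrt_iter[OF linB]])
  qed
  have X_scale: "X (c *\<^sub>R x) = c *\<^sub>R X x" for c x
  proof (rule LIMSEQ_unique[OF X])
    show "(\<lambda>n. sqrt_iter B n (c *\<^sub>R x)) \<longlonglongrightarrow> c *\<^sub>R X x"
      using tendsto_scaleR[OF tendsto_const[of c] X[of x]]
      by (simp add: linear_scale[OF linear_sqrt_iter[OF linB]])
  qed
  have X_bl: "bounded_linear X"
    by (rule bounded_linear_intro[where K = 1]) (auto simp: X_add X_scale X_norm)
  have X_sa: "inner (X x) y = inner x (X y)" for x y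
  proof (rule LIMSEQ_unique)
    show "(\<lambda>n. inner (sqrt_iter B n x) y) \<longlonglongrightarrow> inner (X x) y" by (intro tendsto_intros X)
    show "(\<lambda>n. inner (sqrt_iter B n x) y) \<longlonglongrightarrow> inner x (X y)"
      unfolding sqrt_iter_selfadjoint[of B, OF psd_selfadjoint[OF B]] by (intro tendsto_intros X)
  qed
  have X_comm: "C (X x) = X (C x)"
    if C: "bounded_linear C" "\<And>x. C (A x) = A (C x)" for C x
  proof (rule LIMSEQ_unique[OF _ X])
    have "C (B x) = B (C x)" for x
      using C bounded_linear.linear[OF C(1)] by (simp add: B_def linear_diff)
    then have "C (sqrt_iter B n x) = sqrt_iter B n (C x)" for n
      by (rule sqrt_iter_commute[OF bounded_linear.linear[OF C(1)]])
    with bounded_linear.tendsto[OF C(1) X[of x]] show "(\<lambda>n. sqrt_iter B n (C x)) \<longlonglongrightarrow> C (X x)"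
      by simp
  qed
  have XX: "(\<lambda>n. sqrt_iter B n (sqrt_iter B n x)) \<longlonglongrightarrow> X (X x)" for x
  proof -
    \<comment> \<open>Both factors vary with \<open>n\<close>. The uniform bound
      \<open>X_le1\<close> controls the outer iterate on the error of the inner one, leaving only
      the outer iterate at the fixed vector \<open>X x\<close>.\<close>
    have "(\<lambda>n. sqrt_iter B n (sqrt_iter B n x - X x)) \<longlonglongrightarrow> 0"
    proof (rule Lim_null_comparison)
      show "(\<lambda>n. norm (sqrt_iter B n x - X x)) \<longlonglongrightarrow> 0"
        using X[of x] by (simp add: LIM_zero tendsto_norm_zero)
    qed (simp add: X_le1)
    from tendsto_add[OF this X[of "X x"]] show ?thesis
      by (simp add: linear_diff[OF linear_sqrt_iter[OF linB]])
  qed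
  have X_eq: "X x = (1/2) *\<^sub>R (B x + X (X x))" for x
  proof (rule LIMSEQ_unique)
    show "(\<lambda>n. sqrt_iter B (Suc n) x) \<longlonglongrightarrow> X x" by (rule LIMSEQ_Suc[OF X])
    show "(\<lambda>n. sqrt_iter B (Suc n) x) \<longlonglongrightarrow> (1/2) *\<^sub>R (B x + X (X x))"
      unfolding sqrt_iter.simps by (intro tendsto_intros XX)
  qed
  show ?thesis
  proof (intro exI[of _ "\<lambda>x. x - X x"] conjI allI impI)
    have "inner (X x) x \<le> (norm x)\<^sup>2" for x
      using norm_cauchy_schwarz[of "X x" x] mult_right_mono[OF X_norm[of x] norm_ge_zero[of x]]
      by (simp add: power2_eq_square)
    then show "psd (\<lambda>x. x - X x)"
      using X_bl X_sa
      by (auto simp: psd_def inner_simps power2_norm_eq_inner intro!: bounded_linear_intros)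
    show "(x - X x) - X (x - X x) = A x" for x
    proof -
      have "2 *\<^sub>R X x = B x + X (X x)"
        using arg_cong[OF X_eq[of x], of "\<lambda>z. 2 *\<^sub>R z"] by simp
      then show ?thesis
        using bounded_linear.linear[OF X_bl] by (simp add: linear_diff B_def scaleR_2 algebra_simps)
    qed
    show "C (x - X x) = C x - X (C x)"
      if C: "bounded_linear C" "\<forall>x. C (A x) = A (C x)" for C x
      using X_comm[OF C(1)] C(2) bounded_linear.linear[OF C(1)] by (simp add: linear_diff)
  qed
qed

text \<open>Dividing by a norm bound \<open>K\<close> reduces to the contractive case; the root is
  then multiplied by \<open>sqrt K\<close>.\<close>

lemma psd_sqrt_exists:
  fixes A :: "'a::{real_inner,complete_space} \<Rightarrow> 'a"
  assumes A: "psd A"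
  shows "\<exists>R. psd R \<and> (\<forall>x. R (R x) = A x) \<and>
    (\<forall>C. bounded_linear C \<longrightarrow> (\<forall>x. C (A x) = A (C x)) \<longrightarrow> (\<forall>x. C (R x) = R (C x)))"
proof -
  obtain K where K: "0 < K" "\<And>x. norm (A x) \<le> norm x * K"
    using bounded_linear.pos_bounded[OF psd_bounded_linear[OF A]] by blast
  define A' where "A' x = (1/K) *\<^sub>R A x" for x
  have A': "psd A'"
    using A K unfolding psd_def A'_def[abs_def] by (auto intro!: bounded_linear_intros)
  have "inner (A' x) x \<le> (norm x)\<^sup>2" for x
  proof -
    have "inner (A x) x \<le> norm x * K * norm x"
      using norm_cauchy_schwarz[of "A x" x] mult_right_mono[OF K(2)[of x] norm_ge_zero[of x]]
      by linarith
    with K(1) show ?thesis by (simp add: A'_def field_simps power2_eq_square)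
  qed
  with A' obtain R where R: "psd R" "\<And>x. R (R x) = A' x"
    "\<forall>C. bounded_linear C \<longrightarrow> (\<forall>x. C (A' x) = A' (C x)) \<longrightarrow> (\<forall>x. C (R x) = R (C x))"
    using psd_contraction_sqrt_exists by blast
  show ?thesis
  proof (intro exI[of _ "\<lambda>x. sqrt K *\<^sub>R R x"] conjI allI impI)
    show "psd (\<lambda>x. sqrt K *\<^sub>R R x)"
      using R(1) K by (auto simp: psd_def intro!: bounded_linear_intros)
    show "sqrt K *\<^sub>R R (sqrt K *\<^sub>R R x) = A x" for x
      using R(2) K psd_linear[OF R(1)] by (simp add: linear_scale A'_def)
    show "C (sqrt K *\<^sub>R R x) = sqrt K *\<^sub>R R (C x)"
      if C: "bounded_linear C" "\<forall>x. C (A x) = A (C x)" for C x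
      using R(3) C bounded_linear.linear[OF C(1)] by (simp add: linear_scale A'_def)
  qed
qed

text \<open>Any root \<open>S\<close> commutes with its square \<open>A\<close>, hence with the
  constructed root \<open>R\<close>. For \<open>y = R x - S x\<close> this gives
  \<open>R y + S y = 0\<close>; both forms are nonnegative, so both vanish at \<open>y\<close>, and
  then \<open>R y = S y = 0\<close>. Moving \<open>R - S\<close> across the inner product yields
  \<open>y = 0\<close>.\<close>

lemma psd_sqrt_unique:
  fixes A :: "'a::{real_inner,complete_space} \<Rightarrow> 'a"
  assumes P: "psd P" "\<And>x. P (P x) = A x" and Q: "psd Q" "\<And>x. Q (Q x) = A x"
  shows "P = Q"
proof -
  have "psd A"
    unfolding psd_def P(2)[symmetric, abs_def]
    using bounded_linear_compose[OF psd_bounded_linear psd_bounded_linear, OF P(1) P(1)]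
    by (simp add: psd_selfadjoint[OF P(1)]) (metis inner_ge_zero psd_selfadjoint[OF P(1)])
  then obtain R where R: "psd R" "\<And>x. R (R x) = A x"
    "\<forall>C. bounded_linear C \<longrightarrow> (\<forall>x. C (A x) = A (C x)) \<longrightarrow> (\<forall>x. C (R x) = R (C x))"
    using psd_sqrt_exists by blast
  have "S = R" if S: "psd S" "\<And>x. S (S x) = A x" for S
  proof
    fix x
    have "S (A x) = A (S x)" for x by (simp only: S(2)[symmetric])
    then have comm: "S (R x) = R (S x)" for x using R(3) psd_bounded_linear[OF S(1)] by blast
    define y where "y = R x - S x"
    have "R y + S y = 0"
      unfolding y_def using psd_linear[OF R(1)] psd_linear[OF S(1)] R(2) S(2) comm
      by (simp add: linear_diff)
    then have "inner (R y) y + inner (S y) y = 0" by (metis inner_add_left inner_zero_left)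
    then have "inner (R y) y = 0" "inner (S y) y = 0"
      using psd_nonneg[OF R(1), of y] psd_nonneg[OF S(1), of y] by linarith+
    then have "R y = 0" "S y = 0" using psd_eq_0 R(1) S(1) by blast+
    have "inner y y = inner x (R y) - inner x (S y)"
      unfolding y_def by (simp add: inner_diff_left psd_selfadjoint[OF R(1)] psd_selfadjoint[OF S(1)])
    then have "inner y y = 0" using \<open>R y = 0\<close> \<open>S y = 0\<close> by simp
    then show "S x = R x" unfolding y_def by simp
  qed
  then show ?thesis using P Q by metis
qed

section \<open>Bounded complex linear operators\<close>

text \<open>The imaginary part is a real inner product with \<open>\<i> *\<^sub>C x\<close>, so
  complex identities can be verified on \<open>inner\<close> alone.\<close>

lemma cinner_eq_Complex: "cinner x y = Complex (inner x y) (- inner (\<i> *\<^sub>C x) y)"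
  by (simp add: complex_eq_iff inner_eq_Re_cinner cinner_scaleC_left)

lemma inner_scaleC_left: "inner (c *\<^sub>C x) y = inner x (cnj c *\<^sub>C y)"
proof -
  have "cinner x (cnj c *\<^sub>C y) = cinner (c *\<^sub>C x) y"
    by (subst cinner_commute) (simp add: cinner_scaleC_left cinner_commute[of y x])
  then show ?thesis by (simp add: inner_eq_Re_cinner)
qed

lemma norm_scaleC: "norm (c *\<^sub>C x) = cmod c * norm x"
proof -
  have "inner (c *\<^sub>C x) (c *\<^sub>C x) = inner x ((cnj c * c) *\<^sub>C x)"
    by (simp add: inner_scaleC_left scaleC_scaleC)
  also have "cnj c * c = complex_of_real ((cmod c)\<^sup>2)"
    using complex_norm_square[of c] by (simp add: mult.commute)
  finally have "(norm (c *\<^sub>C x))\<^sup>2 = (cmod c * norm x)\<^sup>2"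
    by (simp add: scaleR_scaleC[symmetric] power2_norm_eq_inner power_mult_distrib)
  then show ?thesis by simp
qed

lemma bounded_linear_scaleC: "bounded_linear ((*\<^sub>C) c)"
  by (rule bounded_linear_intro[where K = "cmod c"])
    (simp_all add: scaleC_add_right scaleR_scaleC scaleC_scaleC norm_scaleC mult.commute)

lemma scaleC_diff_right: "c *\<^sub>C (x - y) = c *\<^sub>C x - c *\<^sub>C y"
  using linear_diff[OF bounded_linear.linear[OF bounded_linear_scaleC]] .

lemma scaleC_zero_right: "c *\<^sub>C 0 = 0"
  using linear_0[OF bounded_linear.linear[OF bounded_linear_scaleC]] .

lemma bounded_clinearD:
  assumes "bounded_clinear A"
  shows bounded_clinear_bounded_linear: "bounded_linear A"
    and bounded_clinear_linear: "linear A"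
    and bounded_clinear_scaleC: "A (c *\<^sub>C x) = c *\<^sub>C A x"
  using assms by (auto simp: bounded_clinear_def bounded_linear.linear)

lemma bounded_clinear_id: "bounded_clinear id"
  by (simp add: bounded_clinear_def id_def)

lemma bounded_clinear_compose:
  "bounded_clinear A \<Longrightarrow> bounded_clinear B \<Longrightarrow> bounded_clinear (\<lambda>x. A (B x))"
  by (auto simp: bounded_clinear_def bounded_linear_compose)

lemma bounded_clinear_add:
  "bounded_clinear A \<Longrightarrow> bounded_clinear B \<Longrightarrow> bounded_clinear (\<lambda>x. A x + B x)"
  by (auto simp: bounded_clinear_def bounded_linear_add scaleC_add_right)

lemma bounded_clinear_diff:
  "bounded_clinear A \<Longrightarrow> bounded_clinear B \<Longrightarrow> bounded_clinear (\<lambda>x. A x - B x)"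
  by (auto simp: bounded_clinear_def bounded_linear_sub scaleC_diff_right)

lemma bounded_clinear_scaleR:
  "bounded_clinear A \<Longrightarrow> bounded_clinear (\<lambda>x. r *\<^sub>R A x)"
  by (auto simp: bounded_clinear_def scaleR_scaleC scaleC_scaleC mult.commute
      intro!: bounded_linear_compose[OF bounded_linear_scaleC])

lemma cinner_eq_of_inner_eq:
  assumes "\<And>c x. A (c *\<^sub>C x) = c *\<^sub>C A x" "\<And>x y. inner (A x) y = inner x (B y)"
  shows "cinner (A x) y = cinner x (B y)"
  by (simp add: cinner_eq_Complex assms(1)[symmetric] assms(2))

text \<open>Positivity makes the imaginary part of the form vanish; polarizing this and replacing
  \<open>x\<close> by \<open>\<i> *\<^sub>C x\<close> yields symmetry for \<open>inner\<close>.
  Conversely, a symmetric complex linear \<open>A\<close> makes \<open>\<i> *\<^sub>C A x\<close>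
  real-orthogonal to \<open>x\<close>.\<close>

lemma positive_op_iff_psd: "positive_op A \<longleftrightarrow> bounded_clinear A \<and> psd A"
proof
  assume A: "positive_op A"
  then have bcl: "bounded_clinear A" by (simp add: positive_op_def)
  note lin = bounded_clinear_linear[OF bcl] and sc = bounded_clinear_scaleC[OF bcl]
  have "inner (\<i> *\<^sub>C A x) x = 0" for x
    using A by (auto simp: positive_op_def cinner_eq_Complex complex_nonneg_Reals_iff)
  note im = this
  have 1: "inner (\<i> *\<^sub>C A x) y + inner (\<i> *\<^sub>C A y) x = 0" for x y
    using im[of "x + y"] im[of x] im[of y]
    by (simp add: linear_add[OF lin] scaleC_add_right inner_simps)
  have "inner (A x) y = inner x (A y)" for x y
  proof -
    have "inner (\<i> *\<^sub>C \<i> *\<^sub>C A x) y + inner (\<i> *\<^sub>C A y) (\<i> *\<^sub>C x) = 0"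
      using 1[of "\<i> *\<^sub>C x" y] by (simp add: sc)
    moreover have "inner (\<i> *\<^sub>C A y) (\<i> *\<^sub>C x) = inner (A y) x"
      by (simp add: inner_scaleC_left scaleC_scaleC scaleC_one)
    moreover have "\<i> *\<^sub>C \<i> *\<^sub>C A x = - A x"
      using scaleR_scaleC[of "-1" "A x"] by (simp add: scaleC_scaleC)
    ultimately show ?thesis by (simp add: inner_commute)
  qed
  then show "bounded_clinear A \<and> psd A"
    using A by (auto simp: psd_def positive_op_def bounded_clinear_def inner_eq_Re_cinner
        complex_nonneg_Reals_iff)
next
  assume A: "bounded_clinear A \<and> psd A"
  then have psd: "psd A" and bcl: "bounded_clinear A" by auto
  have "inner (\<i> *\<^sub>C A x) x = 0" for x
  proof -
    have "inner (\<i> *\<^sub>C A x) x = inner (A (\<i> *\<^sub>C x)) x" by (simp add: bounded_clinear_scaleC[OF bcl])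
    also have "\<dots> = inner (\<i> *\<^sub>C x) (A x)" by (rule psd_selfadjoint[OF psd])
    also have "\<dots> = inner x (- (\<i> *\<^sub>C A x))"
      using scaleR_scaleC[of "-1" "\<i> *\<^sub>C A x"] by (simp add: inner_scaleC_left scaleC_scaleC)
    finally show ?thesis by (simp add: inner_commute)
  qed
  then show "positive_op A"
    using A psd_nonneg[OF psd]
    by (auto simp: positive_op_def cinner_eq_Complex complex_nonneg_Reals_iff)
qed

text \<open>Uniqueness of the representing vector in \<open>closure (range L)\<close> makes it depend
  linearly on the functional.\<close>

lemma Riesz_range_family:
  fixes L :: "'a::complex_inner \<Rightarrow> 'b::chilbert_space"
    and g :: "'c::complex_inner \<Rightarrow> 'a \<Rightarrow> real"
  assumes L: "linear L" "\<And>c x. L (c *\<^sub>C x) = c *\<^sub>C L x"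
    and g: "\<And>y. linear (g y)" "\<And>x. linear (\<lambda>y. g y x)"
      "\<And>c x y. g (c *\<^sub>C y) x = g y (cnj c *\<^sub>C x)"
    and q: "\<And>y. 0 \<le> q y" "\<And>x y. g y x \<le> q y * norm (L x)"
  shows "\<exists>Z. linear Z \<and> (\<forall>c y. Z (c *\<^sub>C y) = c *\<^sub>C Z y) \<and> (\<forall>y. Z y \<in> closure (range L)) \<and>
    (\<forall>y. norm (Z y) \<le> q y) \<and> (\<forall>x y. inner (L x) (Z y) = g y x)"
proof -
  have "\<exists>z. z \<in> closure (range L) \<and> norm z \<le> q y \<and> (\<forall>x. inner (L x) z = g y x)" for y
    using Riesz_range[OF L(1) g(1) q(1,2), of y] by metis
  then obtain Z where Z: "\<And>y. Z y \<in> closure (range L)" "\<And>y. norm (Z y) \<le> q y"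
      "\<And>x y. inner (L x) (Z y) = g y x"
    by metis
  have sub: "subspace (range L)" by (simp add: linear_subspace_image[OF L(1)])
  have add_cl: "v + w \<in> closure (range L)" if vw: "v \<in> closure (range L)" "w \<in> closure (range L)" for v w
  proof -
    obtain f g where "\<forall>n. f n \<in> range L" "f \<longlonglongrightarrow> v" "\<forall>n. g n \<in> range L" "g \<longlonglongrightarrow> w"
      using vw unfolding closure_sequential by blast
    then have "\<forall>n. f n + g n \<in> range L" "(\<lambda>n. f n + g n) \<longlonglongrightarrow> v + w"
      using subspace_add[OF sub] tendsto_add by blast+
    then show ?thesis unfolding closure_sequential by (intro exI[of _ "\<lambda>n. f n + g n"]) simp
  qed
  have "(*\<^sub>C) c ` closure (range L) \<subseteq> closure (range L)" for c
  proof (rule image_closure_subset)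
    show "continuous_on (closure (range L)) ((*\<^sub>C) c)"
      by (rule linear_continuous_on[OF bounded_linear_scaleC])
    show "(*\<^sub>C) c ` range L \<subseteq> closure (range L)"
      using closure_subset[of "range L"] by (auto simp: L(2)[symmetric])
  qed simp
  then have scale_cl: "c *\<^sub>C v \<in> closure (range L)" if "v \<in> closure (range L)" for c v
    using that by blast
  have 1: "Z (x + y) = Z x + Z y" for x y
    by (rule closure_range_orthogonal_eq_0[where L = L])
      (simp_all add: Z add_cl inner_add_right linear_add[OF g(2)])
  have 2: "Z (c *\<^sub>C y) = c *\<^sub>C Z y" for c y
  proof (rule closure_range_orthogonal_eq_0[where L = L])
    fix x
    have "inner (L x) (c *\<^sub>C Z y) = inner (L (cnj c *\<^sub>C x)) (Z y)"
      by (simp add: L(2) inner_scaleC_left)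
    then show "inner (L x) (Z (c *\<^sub>C y)) = inner (L x) (c *\<^sub>C Z y)" by (simp add: Z(3) g(3))
  qed (simp_all add: Z scale_cl)
  have "linear Z" by (rule linearI) (simp_all add: 1 2 scaleR_scaleC)
  with 2 Z show ?thesis by blast
qed

text \<open>Riesz representation with \<open>L\<close> the identity, applied to the functional
  sending \<open>x\<close> to \<open>inner (A x) y\<close>. The representing vectors depend linearly
  on \<open>y\<close>, and \<open>cadjoint_eqI\<close> identifies this map with the definite
  description.\<close>

lemma
  fixes A :: "'a::chilbert_space \<Rightarrow> 'b::complex_inner"
  assumes A: "bounded_clinear A"
  shows inner_cadjoint: "inner (A x) y = inner x (cadjoint A y)"
    and bounded_clinear_cadjoint: "bounded_clinear (cadjoint A)"
proof -
  obtain K where K: "0 < K" "\<And>x. norm (A x) \<le> norm x * K"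
    using bounded_linear.pos_bounded[OF bounded_clinear_bounded_linear[OF A]] by blast
  note lin = bounded_clinear_linear[OF A]
  have "\<exists>Z. linear Z \<and> (\<forall>c y. Z (c *\<^sub>C y) = c *\<^sub>C Z y) \<and> (\<forall>y. Z y \<in> closure (range (\<lambda>x::'a. x))) \<and>
    (\<forall>y. norm (Z y) \<le> norm y * K) \<and> (\<forall>x y. inner x (Z y) = inner (A x) y)"
  proof (rule Riesz_range_family[where q = "\<lambda>y. norm y * K"])
    show "linear (\<lambda>x. inner (A x) y)" for y
      by (rule linearI) (simp_all add: linear_add[OF lin] linear_scale[OF lin] inner_simps)
    show "linear (\<lambda>y. inner (A x) y)" for x
      by (rule linearI) (simp_all add: inner_simps)
    show "inner (A x) (c *\<^sub>C y) = inner (A (cnj c *\<^sub>C x)) y" for c x y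
      by (simp add: bounded_clinear_scaleC[OF A] inner_scaleC_left)
    show "inner (A x) y \<le> norm y * K * norm x" for x y
      using norm_cauchy_schwarz[of "A x" y] mult_right_mono[OF K(2)[of x] norm_ge_zero[of y]]
      by (simp add: mult_ac)
  qed (use K in \<open>auto simp: linear_iff\<close>)
  then obtain Z where Z: "linear Z" "\<And>c y. Z (c *\<^sub>C y) = c *\<^sub>C Z y" "\<And>y. norm (Z y) \<le> norm y * K"
      "\<And>x y. inner (A x) y = inner x (Z y)"
    by metis
  have eq: "cinner (A x) y = cinner x (Z y)" for x y
    by (rule cinner_eq_of_inner_eq) (simp_all add: Z(4) bounded_clinear_scaleC[OF A])
  then have Zeq: "cadjoint A = Z" by (rule cadjoint_eqI)
  then show "inner (A x) y = inner x (cadjoint A y)" by (simp add: Z(4))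
  have "bounded_linear Z"
    by (rule bounded_linear_intro[where K = K]) (simp_all add: Z linear_add linear_scale)
  then show "bounded_clinear (cadjoint A)" using Z(2) Zeq by (simp add: bounded_clinear_def)
qed

lemma cadjoint_eqI_inner:
  assumes "bounded_clinear A" "\<And>x y. inner (A x) y = inner x (B y)"
  shows "cadjoint A = B"
  by (rule cadjoint_eqI, rule cinner_eq_of_inner_eq)
    (simp_all add: assms bounded_clinear_scaleC[OF assms(1)])

lemma cadjoint_cadjoint:
  fixes A :: "'a::chilbert_space \<Rightarrow> 'b::chilbert_space"
  assumes A: "bounded_clinear A"
  shows "cadjoint (cadjoint A) = A"
  by (rule cadjoint_eqI_inner[OF bounded_clinear_cadjoint[OF A]])
    (metis A inner_cadjoint inner_commute)

section \<open>Positive square roots of complex linear operators, and factorization through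
  them\<close>

lemma op_sqrt_eqI:
  fixes A :: "'a::chilbert_space \<Rightarrow> 'a"
  assumes "positive_op R" "\<And>x. R (R x) = A x"
  shows "op_sqrt A = R"
  unfolding op_sqrt_def
proof (rule the_equality)
  fix Q assume "positive_op Q \<and> Q \<circ> Q = A"
  then show "Q = R"
    using assms by (intro psd_sqrt_unique[where A = A]) (auto simp: positive_op_iff_psd o_def)
qed (use assms in \<open>auto simp: o_def\<close>)

lemma
  fixes A :: "'a::chilbert_space \<Rightarrow> 'a"
  assumes A: "positive_op A"
  shows positive_op_sqrt: "positive_op (op_sqrt A)"
    and op_sqrt_op_sqrt: "op_sqrt A (op_sqrt A x) = A x"
proof -
  have A': "psd A" "bounded_clinear A" using A by (auto simp: positive_op_iff_psd)
  obtain R where R: "psd R" "\<And>x. R (R x) = A x"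
    "\<forall>C. bounded_linear C \<longrightarrow> (\<forall>x. C (A x) = A (C x)) \<longrightarrow> (\<forall>x. C (R x) = R (C x))"
    using psd_sqrt_exists[OF A'(1)] by blast
  have "R (c *\<^sub>C x) = c *\<^sub>C R x" for c x
    using R(3) bounded_linear_scaleC[of c] bounded_clinear_scaleC[OF A'(2)] by metis
  then have pos: "positive_op R"
    using R(1) by (auto simp: positive_op_iff_psd bounded_clinear_def psd_def)
  from op_sqrt_eqI[OF this R(2)] have "op_sqrt A = R" .
  with pos R(2) show "positive_op (op_sqrt A)" "op_sqrt A (op_sqrt A x) = A x" by auto
qed

text \<open>This passes from the range of \<open>A\<close> to that of its root. If \<open>z\<close>
  is the projection of \<open>R y\<close> to the closed range of the square, then
  \<open>z - R y\<close> is orthogonal to that range, so \<open>R (z - R y) = 0\<close>. Thus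
  \<open>z - R y\<close> is orthogonal to the range of \<open>R\<close> while lying in its closure,
  and vanishes.\<close>

lemma closure_range_square:
  fixes R :: "'a::{real_inner,complete_space} \<Rightarrow> 'a"
  assumes R: "psd R"
  shows "closure (range (\<lambda>x. R (R x))) = closure (range R)"
proof (rule antisym)
  show "closure (range (\<lambda>x. R (R x))) \<subseteq> closure (range R)"
    by (intro closure_mono) auto
  note lin = psd_linear[OF R]
  have linRR: "linear (\<lambda>x. R (R x))"
    using linear_compose[OF lin lin] by (simp add: o_def)
  have "R y \<in> closure (range (\<lambda>x. R (R x)))" for y
  proof -
    obtain z where z: "z \<in> closure (range (\<lambda>x. R (R x)))"
        "\<And>x. inner (R (R x)) z = inner (R (R x)) (R y)"
    proof (rule Riesz_range[OF linRR, of "\<lambda>x. inner (R (R x)) (R y)" "norm (R y)"])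
      show "linear (\<lambda>x. inner (R (R x)) (R y))"
        by (rule linearI) (simp_all add: linear_add[OF lin] linear_scale[OF lin] inner_simps)
    qed (simp_all add: norm_cauchy_schwarz mult.commute[of "norm (R y)"])
    have 0: "inner (R x) (R (z - R y)) = 0" for x
      using z(2)[of x] by (simp add: psd_selfadjoint[OF R, of "R x"] linear_diff[OF lin] inner_diff_right)
    have "R (z - R y) = 0" using 0[of "z - R y"] unfolding inner_eq_zero_iff .
    then have "inner (R x) z = inner (R x) (R y)" for x
      by (metis eq_iff_diff_eq_0 linear_diff[OF lin] psd_selfadjoint[OF R])
    moreover have "z \<in> closure (range R)"
      using z(1) \<open>closure (range (\<lambda>x. R (R x))) \<subseteq> closure (range R)\<close> by blast
    ultimately have "z = R y"
      using closure_subset[of "range R"]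
      by (intro closure_range_orthogonal_eq_0[where L = R]) auto
    with z(1) show ?thesis by simp
  qed
  then show "closure (range R) \<subseteq> closure (range (\<lambda>x. R (R x)))"
    by (intro closure_minimal) auto
qed

text \<open>A variant of Douglas' lemma: the given bound is the positivity of the block operator with
  rows \<open>(R\<^sup>2, N)\<close> and \<open>(N\<^sup>*, R\<^sup>2)\<close>. The two applications of Riesz'
  theorem produce first \<open>Z = K\<^sup>* R\<close> and then \<open>K\<close>.\<close>

lemma psd_factorization:
  fixes R N :: "'a::chilbert_space \<Rightarrow> 'a"
  assumes R: "positive_op R" and N: "bounded_clinear N"
    and bound: "\<And>x y. inner (N x) y \<le> norm (R x) * norm (R y)"
  obtains K where "contraction_on UNIV K" "\<And>w. K w \<in> closure (range R)" "\<And>x. N x = R (K (R x))"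
proof -
  have R': "psd R" "bounded_clinear R" using R by (auto simp: positive_op_iff_psd)
  note linN = bounded_clinear_linear[OF N] and linR = bounded_clinear_linear[OF R'(2)]
  have "\<exists>Z. linear Z \<and> (\<forall>c y. Z (c *\<^sub>C y) = c *\<^sub>C Z y) \<and> (\<forall>y. Z y \<in> closure (range R)) \<and>
    (\<forall>y. norm (Z y) \<le> norm (R y)) \<and> (\<forall>x y. inner (R x) (Z y) = inner (N x) y)"
  proof (rule Riesz_range_family)
    show "linear (\<lambda>x. inner (N x) y)" for y
      by (rule linearI) (simp_all add: linear_add[OF linN] linear_scale[OF linN] inner_simps)
    show "linear (\<lambda>y. inner (N x) y)" for x
      by (rule linearI) (simp_all add: inner_simps)
    show "inner (N x) (c *\<^sub>C y) = inner (N (cnj c *\<^sub>C x)) y" for c x y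
      by (simp add: bounded_clinear_scaleC[OF N] inner_scaleC_left)
    show "inner (N x) y \<le> norm (R y) * norm (R x)" for x y
      using bound[of x y] by (simp add: mult.commute)
  qed (use linR bounded_clinear_scaleC[OF R'(2)] in auto)
  then obtain Z where Z: "linear Z" "\<And>c y. Z (c *\<^sub>C y) = c *\<^sub>C Z y"
      "\<And>y. norm (Z y) \<le> norm (R y)" "\<And>x y. inner (R x) (Z y) = inner (N x) y"
    by metis
  have "\<exists>K. linear K \<and> (\<forall>c w. K (c *\<^sub>C w) = c *\<^sub>C K w) \<and> (\<forall>w. K w \<in> closure (range R)) \<and>
    (\<forall>w. norm (K w) \<le> norm w) \<and> (\<forall>y w. inner (R y) (K w) = inner (Z y) w)"
  proof (rule Riesz_range_family)
    show "linear (\<lambda>y. inner (Z y) w)" for w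
      by (rule linearI) (simp_all add: linear_add[OF Z(1)] linear_scale[OF Z(1)] inner_simps)
    show "linear (\<lambda>w. inner (Z y) w)" for y
      by (rule linearI) (simp_all add: inner_simps)
    show "inner (Z y) (c *\<^sub>C w) = inner (Z (cnj c *\<^sub>C y)) w" for c y w
      by (simp add: Z(2) inner_scaleC_left)
    show "inner (Z y) w \<le> norm w * norm (R y)" for y w
      using norm_cauchy_schwarz[of "Z y" w] mult_right_mono[OF Z(3)[of y] norm_ge_zero[of w]]
      by (simp add: mult_ac)
  qed (use linR bounded_clinear_scaleC[OF R'(2)] in auto)
  then obtain K where K: "linear K" "\<And>c w. K (c *\<^sub>C w) = c *\<^sub>C K w" "\<And>w. K w \<in> closure (range R)"
      "\<And>w. norm (K w) \<le> norm w" "\<And>y w. inner (R y) (K w) = inner (Z y) w"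
    by metis
  show thesis
  proof (rule that)
    show "contraction_on UNIV K"
      using K by (simp add: contraction_on_def linear_add)
    show "N x = R (K (R x))" for x
    proof -
      \<comment> \<open>The two defining relations chain: pairing \<open>y\<close> with
        \<open>R (K (R x))\<close> equals pairing \<open>Z y\<close> with \<open>R x\<close>, which
        is \<open>inner (N x) y\<close>.\<close>
      have "inner y (N x) = inner y (R (K (R x)))" for y
        by (metis K(5) Z(4) inner_commute psd_selfadjoint[OF R'(1)])
      then show ?thesis by (metis vector_eq_ldot)
    qed
  qed (rule K(3))
qed

lemma contraction_iff: "contraction A \<longleftrightarrow> bounded_clinear A \<and> (\<forall>x. norm (A x) \<le> norm x)"
  for A :: "'a::complex_inner \<Rightarrow> 'a"
proof
  assume A: "contraction A"
  then have "contraction_on UNIV A" by (simp add: contraction_on_UNIV)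
  with A show "bounded_clinear A \<and> (\<forall>x. norm (A x) \<le> norm x)"
    by (simp add: contraction_def contraction_on_def)
next
  assume "bounded_clinear A \<and> (\<forall>x. norm (A x) \<le> norm x)"
  then show "contraction A"
    by (auto simp: contraction_def intro: onorm_bound)
qed

section \<open>Closure properties of bounded complex linear operators\<close>

lemma bounded_clinear_Pair:
  "bounded_clinear A \<Longrightarrow> bounded_clinear B \<Longrightarrow> bounded_clinear (\<lambda>x. (A x, B x))"
  by (auto simp: bounded_clinear_def bounded_linear_Pair scaleC_prod_def)

lemma bounded_clinear_fst: "bounded_clinear A \<Longrightarrow> bounded_clinear (\<lambda>x. fst (A x))"
  by (auto simp: bounded_clinear_def scaleC_prod_def
      intro!: bounded_linear_compose[OF bounded_linear_fst])

lemma bounded_clinear_snd: "bounded_clinear A \<Longrightarrow> bounded_clinear (\<lambda>x. snd (A x))"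
  by (auto simp: bounded_clinear_def scaleC_prod_def
      intro!: bounded_linear_compose[OF bounded_linear_snd])

lemma bounded_clinear_ident: "bounded_clinear (\<lambda>x. x)"
  using bounded_clinear_id by (simp add: id_def)

lemma bounded_clinear_zero: "bounded_clinear (\<lambda>x. 0)"
  by (simp add: bounded_clinear_def scaleC_zero_right)

lemmas bounded_clinear_intros =
  bounded_clinear_Pair bounded_clinear_fst bounded_clinear_snd bounded_clinear_ident
  bounded_clinear_zero bounded_clinear_add bounded_clinear_diff bounded_clinear_scaleR
  bounded_clinear_cadjoint

lemma bounded_clinear_block_op:
  assumes "bounded_clinear A" "bounded_clinear B" "bounded_clinear C" "bounded_clinear D"
  shows "bounded_clinear (block_op A B C D)"
  unfolding block_op_def case_prod_beta
  by (intro bounded_clinear_intros bounded_clinear_compose[OF assms(1)]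
      bounded_clinear_compose[OF assms(2)] bounded_clinear_compose[OF assms(3)]
      bounded_clinear_compose[OF assms(4)])

section \<open>Block operators\<close>

text \<open>Symmetry makes the lower left entry the adjoint of the upper right one. This gives the
  block form both of the square root defining \<open>half_op\<close> and of
  \<open>\<Gamma>\<close>.\<close>

lemma selfadjoint_block_op:
  fixes W :: "'a::chilbert_space \<times> 'a \<Rightarrow> 'a \<times> 'a"
  assumes W: "bounded_clinear W" "\<And>x y. inner (W x) y = inner x (W y)"
  defines "P \<equiv> \<lambda>x. fst (W (x, 0))" and "S \<equiv> \<lambda>x. fst (W (0, x))" and "Q \<equiv> \<lambda>x. snd (W (0, x))"
  shows "bounded_clinear P" "bounded_clinear S" "bounded_clinear Q"
    and "W = block_op P S (cadjoint S) Q"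
proof -
  show P: "bounded_clinear P" and S: "bounded_clinear S" and Q: "bounded_clinear Q"
    unfolding P_def S_def Q_def
    by (intro bounded_clinear_intros bounded_clinear_compose[OF W(1)])+
  have "inner (S x) y = inner x (snd (W (y, 0)))" for x y
    using W(2)[of "(0, x)" "(y, 0)"] by (simp add: inner_prod_def S_def)
  then have S': "cadjoint S = (\<lambda>y. snd (W (y, 0)))" by (intro cadjoint_eqI_inner S)
  show "W = block_op P S (cadjoint S) Q"
  proof
    fix z :: "'a \<times> 'a"
    obtain x y where z: "z = (x, y)" by (cases z)
    have "W z = W (x, 0) + W (0, y)"
      using linear_add[OF bounded_clinear_linear[OF W(1)], of "(x, 0)" "(0, y)"] by (simp add: z)
    then show "W z = block_op P S (cadjoint S) Q z"
      unfolding z block_op_def S' by (simp add: P_def S_def Q_def prod_eq_iff)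
  qed
qed

lemma positive_op_block_contraction:
  fixes C :: "'a::chilbert_space \<Rightarrow> 'a"
  assumes "contraction C"
  shows "positive_op (block_op id C (cadjoint C) id)"
proof -
  have C: "bounded_clinear C" "\<And>x. norm (C x) \<le> norm x" using assms by (auto simp: contraction_iff)
  note adj = inner_cadjoint[OF C(1)]
  have adj': "inner (cadjoint C x) y = inner x (C y)" for x y
    by (metis adj inner_commute)
  have "psd (block_op id C (cadjoint C) id)"
    unfolding psd_def
  proof (intro conjI allI)
    show "bounded_linear (block_op id C (cadjoint C) id)"
      by (intro bounded_clinear_bounded_linear bounded_clinear_block_op bounded_clinear_id C
          bounded_clinear_cadjoint)
    fix z w :: "'a \<times> 'a"
    show "inner (block_op id C (cadjoint C) id z) w = inner z (block_op id C (cadjoint C) id w)"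
      by (cases z; cases w) (simp add: block_op_def inner_prod_def inner_simps adj adj')
    obtain x y where z: "z = (x, y)" by (cases z)
    have "\<bar>inner (C y) x\<bar> \<le> norm y * norm x"
      using Cauchy_Schwarz_ineq2[of "C y" x] mult_right_mono[OF C(2)[of y] norm_ge_zero[of x]]
      by linarith
    moreover have "0 \<le> (norm x - norm y)\<^sup>2" by simp
    ultimately have "0 \<le> inner x x + inner y y + 2 * inner (C y) x"
      by (simp add: power2_diff power2_norm_eq_inner[symmetric] algebra_simps)
    also have "\<dots> = inner (block_op id C (cadjoint C) id z) z"
      by (simp add: z block_op_def inner_prod_def inner_simps adj' inner_commute[of "C y" x])
    finally show "0 \<le> inner (block_op id C (cadjoint C) id z) z" .
  qed
  then show ?thesis
    by (simp add: positive_op_iff_psd bounded_clinear_block_op bounded_clinear_id C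
        bounded_clinear_cadjoint)
qed

text \<open>The diagonal corners \<open>P\<close> and \<open>Q\<close> of the root are positive. The
  diagonal entries of its square say that the square of \<open>P\<close> is
  \<open>I - S (cadjoint S)\<close> and the square of \<open>Q\<close> is
  \<open>I - (cadjoint S) S\<close>, so uniqueness of roots identifies them as defect
  operators.\<close>

lemma op_sqrt_block_contraction:
  fixes C :: "'a::chilbert_space \<Rightarrow> 'a"
  assumes C: "contraction C"
  defines "S \<equiv> half_op C"
  shows "op_sqrt (block_op id C (cadjoint C) id) = block_op (defect (cadjoint S)) S (cadjoint S) (defect S)"
    and "bounded_clinear (defect (cadjoint S))" "bounded_clinear S" "bounded_clinear (defect S)"
proof -
  let ?M = "block_op id C (cadjoint C) id"
  define R where "R = op_sqrt ?M"
  note M = positive_op_block_contraction[OF C]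
  have R: "bounded_clinear R" "psd R" and RR: "R (R z) = ?M z" for z
    using positive_op_sqrt[OF M] op_sqrt_op_sqrt[OF M] by (auto simp: R_def positive_op_iff_psd)
  define P where "P = (\<lambda>x. fst (R (x, 0)))"
  define Q where "Q = (\<lambda>x. snd (R (0, x)))"
  have S_eq: "S = (\<lambda>x. fst (R (0, x)))" by (simp add: S_def half_op_def R_def)
  note blk = selfadjoint_block_op[OF R(1) psd_selfadjoint[OF R(2)], folded P_def Q_def S_eq]
  note S' = cadjoint_cadjoint[OF blk(2)]
  have "psd P" "psd Q"
  proof -
    have "inner (P x) y = inner x (P y)" "0 \<le> inner (P x) x"
         "inner (Q x) y = inner x (Q y)" "0 \<le> inner (Q x) x" for x y
      using psd_selfadjoint[OF R(2), of "(x, 0)" "(y, 0)"] psd_nonneg[OF R(2), of "(x, 0)"]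
        psd_selfadjoint[OF R(2), of "(0, x)" "(0, y)"] psd_nonneg[OF R(2), of "(0, x)"]
      by (simp_all add: P_def Q_def inner_prod_def)
    then show "psd P" "psd Q" using blk by (simp_all add: psd_def bounded_clinear_bounded_linear)
  qed
  then have PQ: "positive_op P" "positive_op Q" using blk by (simp_all add: positive_op_iff_psd)
  note lin = bounded_clinear_linear[OF bounded_clinear_cadjoint[OF blk(2)]]
    bounded_clinear_linear[OF blk(1)] bounded_clinear_linear[OF blk(2)] bounded_clinear_linear[OF blk(3)]
  have "C 0 = 0" "cadjoint C 0 = 0"
    using C by (simp_all add: contraction_iff linear_0 bounded_clinear_linear bounded_clinear_cadjoint)
  have "P (P x) + S (cadjoint S x) = x" for x
    using RR[of "(x, 0)"] unfolding blk(4)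
    by (simp add: block_op_def linear_0[OF lin(1)] linear_0[OF lin(2)] linear_0[OF lin(3)]
        linear_0[OF lin(4)] \<open>C 0 = 0\<close> \<open>cadjoint C 0 = 0\<close>)
  then have "defect (cadjoint S) = P"
    unfolding defect_def S' by (intro op_sqrt_eqI PQ) (simp add: eq_diff_eq)
  moreover have "cadjoint S (S x) + Q (Q x) = x" for x
    using RR[of "(0, x)"] unfolding blk(4)
    by (simp add: block_op_def linear_0[OF lin(1)] linear_0[OF lin(2)] linear_0[OF lin(3)]
        linear_0[OF lin(4)] \<open>C 0 = 0\<close> \<open>cadjoint C 0 = 0\<close>)
  then have "defect S = Q"
    unfolding defect_def by (intro op_sqrt_eqI PQ) (simp add: eq_diff_eq add.commute)
  ultimately show "op_sqrt ?M = block_op (defect (cadjoint S)) S (cadjoint S) (defect S)"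
    "bounded_clinear (defect (cadjoint S))" "bounded_clinear S" "bounded_clinear (defect S)"
    using blk by (simp_all add: R_def[symmetric])
qed

text \<open>Forwards, scaling \<open>u\<close> by a real \<open>t\<close> gives a nonnegative
  quadratic and hence a discriminant bound. Backwards, use the bound at \<open>- v\<close> and
  \<open>2 a b \<le> a\<^sup>2 + b\<^sup>2\<close>.\<close>

lemma block_form_nonneg_iff:
  assumes R: "psd R" "\<And>x. R (R x) = A x" and N: "linear N"
  shows "(\<forall>u v. 0 \<le> inner (A u) u + inner (A v) v + 2 * inner (N v) u)
    \<longleftrightarrow> (\<forall>u v. inner (N v) u \<le> norm (R v) * norm (R u))"
proof -
  have A: "inner (A x) x = (norm (R x))\<^sup>2" for x
    by (simp add: R(2)[symmetric] power2_norm_eq_inner psd_selfadjoint[OF R(1)])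
  note linR = psd_linear[OF R(1)]
  show ?thesis
  proof (intro iffI allI)
    fix u v
    assume *: "\<forall>u v. 0 \<le> inner (A u) u + inner (A v) v + 2 * inner (N v) u"
    have "0 \<le> (norm (R u))\<^sup>2 * t\<^sup>2 + 2 * inner (N v) u * t + (norm (R v))\<^sup>2" for t
      using *[rule_format, of "t *\<^sub>R u" v, unfolded A]
      by (simp add: linear_scale[OF linR] power_mult_distrib algebra_simps)
    from discriminant_le[OF _ this] have "(inner (N v) u)\<^sup>2 \<le> (norm (R v) * norm (R u))\<^sup>2"
      by (simp add: power_mult_distrib mult.commute)
    then show "inner (N v) u \<le> norm (R v) * norm (R u)"
      by (rule power2_le_imp_le) simp
  next
    fix u v
    assume *: "\<forall>u v. inner (N v) u \<le> norm (R v) * norm (R u)"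
    have "- inner (N v) u \<le> norm (R v) * norm (R u)"
      using *[rule_format, of "- v" u] by (simp add: linear_neg[OF N] linear_neg[OF linR])
    moreover have "0 \<le> (norm (R u) - norm (R v))\<^sup>2" by simp
    ultimately show "0 \<le> inner (A u) u + inner (A v) v + 2 * inner (N v) u"
      by (simp add: A power2_diff algebra_simps)
  qed
qed

text \<open>The form needed for (4): \<open>K\<close> from \<open>psd_factorization\<close> maps
  into the closed range of the root, which is that of \<open>A\<close> by
  \<open>closure_range_square\<close>. Since \<open>N\<close> is arbitrary, the skew-adjoint
  \<open>T\<^sub>1 - T\<^sub>1\<^sup>*\<close> is covered.\<close>

lemma block_form_nonneg_iff_factorization:
  fixes A N :: "'a::chilbert_space \<Rightarrow> 'a"
  assumes A: "positive_op A" and N: "bounded_clinear N"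
  shows "(\<forall>u v. 0 \<le> inner (A u) u + inner (A v) v + 2 * inner (N v) u)
    \<longleftrightarrow> (\<exists>K. contraction_on (closure (range A)) K \<and> (\<forall>x. N x = op_sqrt A (K (op_sqrt A x))))"
proof -
  define R where "R = op_sqrt A"
  have R: "positive_op R" "\<And>x. R (R x) = A x"
    using positive_op_sqrt[OF A] op_sqrt_op_sqrt[OF A] by (auto simp: R_def)
  then have R': "psd R" by (simp add: positive_op_iff_psd)
  have cl: "closure (range A) = closure (range R)"
    using closure_range_square[OF R'] by (simp add: R(2))
  show ?thesis
    unfolding block_form_nonneg_iff[OF R' R(2) bounded_clinear_linear[OF N]] R_def[symmetric] cl
  proof
    assume "\<forall>u v. inner (N v) u \<le> norm (R v) * norm (R u)"
    then obtain K where "contraction_on UNIV K" "\<And>w. K w \<in> closure (range R)" "\<And>x. N x = R (K (R x))"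
      using psd_factorization[OF R(1) N] by metis
    then show "\<exists>K. contraction_on (closure (range R)) K \<and> (\<forall>x. N x = R (K (R x)))"
      by (intro exI[of _ K]) (auto simp: contraction_on_def)
  next
    assume "\<exists>K. contraction_on (closure (range R)) K \<and> (\<forall>x. N x = R (K (R x)))"
    then obtain K where K: "contraction_on (closure (range R)) K" "\<And>x. N x = R (K (R x))" by blast
    have K_le: "norm (K (R v)) \<le> norm (R v)" for v
      using K(1) subsetD[OF closure_subset, of "R v" "range R"] by (simp add: contraction_on_def)
    have "inner (N v) u \<le> norm (R v) * norm (R u)" for u v
      using norm_cauchy_schwarz[of "K (R v)" "R u"] mult_right_mono[OF K_le[of v] norm_ge_zero[of "R u"]]
      by (simp add: K(2) psd_selfadjoint[OF R'])
    then show "\<forall>u v. inner (N v) u \<le> norm (R v) * norm (R u)" by blast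
  qed
qed

text \<open>If \<open>N = R K R\<close> is self-adjoint, the adjoint of \<open>K\<close> factors it
  as well, so \<open>K\<close> can be averaged with its adjoint; the average is again a
  contraction.\<close>

lemma block_form_nonneg_imp_selfadjoint_factorization:
  fixes A N :: "'a::chilbert_space \<Rightarrow> 'a"
  assumes A: "positive_op A" and N: "bounded_clinear N" "\<And>x y. inner (N x) y = inner x (N y)"
    and nonneg: "\<And>u v. 0 \<le> inner (A u) u + inner (A v) v + 2 * inner (N v) u"
  obtains G where "contraction G" "\<And>x y. inner (G x) y = inner x (G y)"
    "\<And>x. N x = op_sqrt A (G (op_sqrt A x))"
proof -
  define R where "R = op_sqrt A"
  have R: "positive_op R" "\<And>x. R (R x) = A x"
    using positive_op_sqrt[OF A] op_sqrt_op_sqrt[OF A] by (auto simp: R_def)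
  then have R': "psd R" by (simp add: positive_op_iff_psd)
  have "\<forall>u v. inner (N v) u \<le> norm (R v) * norm (R u)"
    using nonneg block_form_nonneg_iff[OF R' R(2) bounded_clinear_linear[OF N(1)]] by blast
  then obtain K where "contraction_on UNIV K" and NK: "\<And>x. N x = R (K (R x))"
    using psd_factorization[OF R(1) N(1)] by metis
  then have K: "bounded_clinear K" "\<And>x. norm (K x) \<le> norm x"
    by (simp_all add: contraction_on_UNIV contraction_iff)
  note adj = inner_cadjoint[OF K(1)]
  have adj': "inner (cadjoint K x) y = inner x (K y)" for x y
    by (metis adj inner_commute)
  have K'_le: "norm (cadjoint K x) \<le> norm x" for x
  proof -
    have "norm (cadjoint K x) * norm (cadjoint K x) = inner (K (cadjoint K x)) x"
      by (simp add: adj power2_norm_eq_inner[symmetric] power2_eq_square)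
    also have "\<dots> \<le> norm (cadjoint K x) * norm x"
      using norm_cauchy_schwarz[of "K (cadjoint K x)" x]
        mult_right_mono[OF K(2)[of "cadjoint K x"] norm_ge_zero[of x]] by linarith
    finally show ?thesis by (cases "cadjoint K x = 0") auto
  qed
  define G where "G x = (1/2) *\<^sub>R (K x + cadjoint K x)" for x
  have "bounded_clinear G"
    unfolding G_def[abs_def] by (intro bounded_clinear_intros K)
  moreover have "norm (G x) \<le> norm x" for x
    using norm_triangle_ineq[of "K x" "cadjoint K x"] K(2)[of x] K'_le[of x] by (simp add: G_def)
  ultimately have "contraction G" by (simp add: contraction_iff)
  moreover have "inner (G x) y = inner x (G y)" for x y
    by (simp add: G_def inner_simps adj adj')
  moreover have "N x = R (G (R x))" for x
  proof -
    have "inner y (N x) = inner y (R (cadjoint K (R x)))" for y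
      by (metis N(2) NK adj psd_selfadjoint[OF R'])
    then have "N x = R (cadjoint K (R x))" by (metis vector_eq_ldot)
    then have "N x = (1/2) *\<^sub>R (R (K (R x)) + R (cadjoint K (R x)))"
      using NK[of x] by (simp add: scaleR_2[symmetric])
    then show ?thesis
      by (simp add: G_def linear_add[OF psd_linear[OF R']] linear_scale[OF psd_linear[OF R']])
  qed
  ultimately show thesis using that unfolding R_def by blast
qed

section \<open>Positive definite maps on the cyclic group of order 4\<close>

lemma minus_type_4: "(4::4) = 0" "- (1::4) = 3" "- (2::4) = 2" "- (3::4) = 1"
proof -
  show "(4::4) = 0" by simp
  then show "- (1::4) = 3" "- (2::4) = 2" "- (3::4) = 1"
    by (intro minus_unique; simp)+
qed

text \<open>Terms off the support vanish, so both sums extend over the whole group;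
  \<open>T (- t + s)\<close> is the entry of \<Delta> in row \<open>t\<close> and column
  \<open>s\<close>.\<close>

lemma sum_support_eq_cinner_Delta_op:
  fixes T :: "4 \<Rightarrow> 'a::chilbert_space \<Rightarrow> 'a"
  assumes T: "\<And>g. bounded_clinear (T g)" "T 0 = id" "T 3 = cadjoint (T 1)"
  shows "(\<Sum>s | h s \<noteq> 0. \<Sum>t | h t \<noteq> 0. cinner (T (- t + s) (h s)) (h t))
    = cinner (Delta_op T (h 0, h 1, h 2, h 3)) (h 0, h 1, h 2, h 3)"
proof -
  have 0: "cinner (T g 0) y = 0" "cinner x (0::'a) = 0" for g x y
    by (simp_all add: cinner_eq_Complex linear_0[OF bounded_clinear_linear[OF T(1)]] scaleC_zero_right
        complex_eq_iff)
  have "(\<Sum>s | h s \<noteq> 0. \<Sum>t | h t \<noteq> 0. cinner (T (- t + s) (h s)) (h t))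
      = (\<Sum>s\<in>UNIV. \<Sum>t\<in>UNIV. cinner (T (- t + s) (h s)) (h t))"
    by (rule trans[OF sum.cong[OF refl sum.mono_neutral_left] sum.mono_neutral_left])
      (auto simp: 0)
  also have "\<dots> = cinner (Delta_op T (h 0, h 1, h 2, h 3)) (h 0, h 1, h 2, h 3)"
    by (simp add: sum_4 Delta_op_def cinner_prod_def cinner_add_left T(2,3) minus_type_4)
  finally show ?thesis .
qed

theorem theorem3p17:
  fixes T :: "4 \<Rightarrow> 'a::chilbert_space \<Rightarrow> 'a"
  assumes "\<And>g. bounded_clinear (T g)"
    and "T 0 = id"
    and "T 1 = cadjoint (T 3)"
    and "T 2 = cadjoint (T 2)"
  shows "(positive_definite T \<longleftrightarrow> positive_op (Delta_op T)) \<and>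
    (positive_definite T \<longleftrightarrow>
      contraction (T 1) \<and>
      (\<exists>\<Gamma>1 \<Gamma>2 \<Gamma>4 :: 'a \<Rightarrow> 'a.
        bounded_clinear \<Gamma>1 \<and> bounded_clinear \<Gamma>2 \<and> bounded_clinear \<Gamma>4 \<and>
        (let \<Gamma>2' = cadjoint \<Gamma>2; \<Gamma> = block_op \<Gamma>1 \<Gamma>2 \<Gamma>2' \<Gamma>4;
             S = half_op (T 1); S' = cadjoint S; D = defect S; D' = defect S'
         in contraction \<Gamma> \<and> cadjoint \<Gamma> = \<Gamma> \<and>
            (\<forall>x. T 2 x = D' (\<Gamma>1 (D' x)) + D' (\<Gamma>2 (S' x)) + S (\<Gamma>2' (D' x)) + S (\<Gamma>4 (S' x))) \<and>
            (\<forall>x. T 2 x = S' (\<Gamma>1 (S x)) + S' (\<Gamma>2 (D x)) + D (\<Gamma>2' (S x)) + D (\<Gamma>4 (D x))) \<and>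
            (\<forall>x. T 1 x = S' (\<Gamma>1 (D' x)) + S' (\<Gamma>2 (S' x)) + D (\<Gamma>2' (D' x)) + D (\<Gamma>4 (S' x)))))) \<and>
    (positive_definite T \<longleftrightarrow>
      contraction (T 1) \<and>
      positive_op (\<lambda>x. x - T 2 x) \<and> positive_op (\<lambda>x. x + T 2 x) \<and>
      (\<exists>\<Gamma>p \<Gamma>m :: 'a \<Rightarrow> 'a.
        contraction_on (closure (range (\<lambda>x. x + T 2 x))) \<Gamma>p \<and>
        contraction_on (closure (range (\<lambda>x. x - T 2 x))) \<Gamma>m \<and>
        (let Rp = op_sqrt (\<lambda>x. x + T 2 x); Rm = op_sqrt (\<lambda>x. x - T 2 x)
         in (\<forall>x. T 1 x + cadjoint (T 1) x = Rp (\<Gamma>p (Rp x))) \<and>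
            (\<forall>x. T 1 x - cadjoint (T 1) x = Rm (\<Gamma>m (Rm x))))))"
proof -

  \<comment> \<open>The quadratic form of \<Delta> in the two groupings of coordinates\<close>
  define T1 where "T1 = T 1"
  define T1' where "T1' = cadjoint T1"
  define T2 where "T2 = T 2"
  have bcl: "bounded_clinear T1" "bounded_clinear T1'" "bounded_clinear T2"
    by (simp_all add: T1_def T2_def T1'_def assms(1) bounded_clinear_cadjoint)
  note lin = this[THEN bounded_clinear_linear]
  have T3: "T 3 = cadjoint (T 1)"
    using cadjoint_cadjoint[OF assms(1)[of 3]] assms(3) by simp
  have adj: "inner (T1 x) y = inner x (T1' y)" for x y
    unfolding T1'_def by (rule inner_cadjoint[OF bcl(1)])
  have adj': "inner (T1' x) y = inner x (T1 y)" for x y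
    by (metis adj inner_commute)
  have sa: "inner (T2 x) y = inner x (T2 y)" for x y
    using inner_cadjoint[OF bcl(3), of x y] assms(4) by (simp add: T2_def)
  note move = adj adj' sa
  \<comment> \<open>Instances of these bring every cross term to one order of its two vectors, so
    that the expanded forms agree term by term.\<close>
  have flips: "inner y x = inner x y" "inner y (T1 x) = inner x (T1' y)"
      "inner y (T1' x) = inner x (T1 y)" "inner y (T2 x) = inner x (T2 y)" for x y
    by (metis inner_commute move)+
  have neg: "T (- s) = cadjoint (T s)" for s
  proof -
    have "cadjoint id = (id :: 'a \<Rightarrow> 'a)" by (rule cadjoint_eqI) simp
    moreover have "\<forall>s. T (- s) = cadjoint (T s)"
      unfolding forall_4 using assms(2-4) T3 calculation by (simp add: minus_type_4)
    ultimately show ?thesis by blast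
  qed
  \<comment> \<open>\<open>M\<close> is the diagonal block of \<Delta> and \<open>B\<close> the
    off-diagonal one, the same in both corners. \<open>E\<close>, \<open>X\<close> and
    \<open>F\<close>, \<open>Y\<close> are the entries on the even and odd parts.\<close>
  define B where "B = block_op T2 T1' T1 T2"
  define M where "M = block_op id T1 T1' id"
  define E where "E x = x + T2 x" for x
  define F where "F x = x - T2 x" for x
  define X where "X x = T1 x + T1' x" for x
  define Y where "Y x = T1 x - T1' x" for x
  have bcl': "bounded_clinear B" "bounded_clinear M" "bounded_clinear E" "bounded_clinear F"
      "bounded_clinear X" "bounded_clinear Y"
    unfolding B_def M_def E_def[abs_def] F_def[abs_def] X_def[abs_def] Y_def[abs_def]
    by (intro bounded_clinear_block_op bounded_clinear_id bounded_clinear_intros bcl)+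
  have Delta: "Delta_op T (x0, x1, x2, x3) =
      (x0 + T1 x1 + T2 x2 + T1' x3, T1' x0 + x1 + T1 x2 + T2 x3,
       T2 x0 + T1' x1 + x2 + T1 x3, T1 x0 + T2 x1 + T1' x2 + x3)" for x0 x1 x2 x3
    by (simp add: Delta_op_def T1_def T1'_def T2_def)
  define q where "q x0 x1 x2 x3 = inner (Delta_op T (x0, x1, x2, x3)) (x0, x1, x2, x3)" for x0 x1 x2 x3
  have q_pairs: "q x0 x1 x2 x3 = inner (M (x0, x1)) (x0, x1) + inner (M (x2, x3)) (x2, x3)
      + 2 * inner (B (x2, x3)) (x0, x1)" for x0 x1 x2 x3
    unfolding q_def Delta M_def B_def block_op_def
    by (simp add: inner_prod_def inner_add_left inner_add_right move flips[of x2 x0]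
        flips[of x3 x0] flips[of x2 x1] flips[of x3 x1])
  \<comment> \<open>The factor 2 appears because the sums and differences are not normalized by
    \<open>1 / sqrt 2\<close>.\<close>
  have q_parity: "2 * q x0 x1 x2 x3 =
      inner (E (x0 + x2)) (x0 + x2) + inner (E (x1 + x3)) (x1 + x3) + 2 * inner (X (x1 + x3)) (x0 + x2)
    + (inner (F (x0 - x2)) (x0 - x2) + inner (F (x1 - x3)) (x1 - x3) + 2 * inner (Y (x1 - x3)) (x0 - x2))"
    for x0 x1 x2 x3
    unfolding q_def Delta E_def F_def X_def Y_def
    by (simp add: inner_prod_def linear_add[OF lin(1)] linear_add[OF lin(2)] linear_add[OF lin(3)]
        linear_diff[OF lin(1)] linear_diff[OF lin(2)] linear_diff[OF lin(3)]
        inner_add_left inner_add_right inner_diff_left inner_diff_right move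
        flips[of x1 x0] flips[of x2 x0] flips[of x3 x0] flips[of x2 x1] flips[of x3 x1] flips[of x3 x2])
  have Delta_iff: "positive_op (Delta_op T) \<longleftrightarrow> (\<forall>x0 x1 x2 x3. 0 \<le> q x0 x1 x2 x3)"
  proof -
    have "Delta_op T = (\<lambda>x. (fst x + T1 (fst (snd x)) + T2 (fst (snd (snd x))) + T1' (snd (snd (snd x))),
        T1' (fst x) + fst (snd x) + T1 (fst (snd (snd x))) + T2 (snd (snd (snd x))),
        T2 (fst x) + T1' (fst (snd x)) + fst (snd (snd x)) + T1 (snd (snd (snd x))),
        T1 (fst x) + T2 (fst (snd x)) + T1' (fst (snd (snd x))) + snd (snd (snd x))))"
      by (auto simp: Delta)
    moreover have "bounded_clinear \<dots>"
      by (intro bounded_clinear_intros bounded_clinear_compose[OF bcl(1)]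
          bounded_clinear_compose[OF bcl(2)] bounded_clinear_compose[OF bcl(3)])
    ultimately have "bounded_clinear (Delta_op T)" by simp
    moreover have "inner (Delta_op T x) y = inner x (Delta_op T y)" for x y
      by (cases x; cases y) (simp add: Delta inner_prod_def inner_add_left inner_add_right move)
    ultimately show ?thesis
      by (auto simp: positive_op_iff_psd psd_def bounded_clinear_bounded_linear q_def)
  qed
  have pd: "positive_definite T \<longleftrightarrow> positive_op (Delta_op T)"
  proof
    assume pd: "positive_definite T"
    have "0 \<le> q x0 x1 x2 x3" for x0 x1 x2 x3
    proof -
      define h :: "4 \<Rightarrow> 'a" where "h s = (if s = 0 then x0 else if s = 1 then x1 else if s = 2 then x2 else x3)" for s
      have "cinner (Delta_op T (h 0, h 1, h 2, h 3)) (h 0, h 1, h 2, h 3) \<in> \<real>\<^sub>\<ge>\<^sub>0"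
        using pd unfolding positive_definite_def
          sum_support_eq_cinner_Delta_op[OF assms(1,2) T3] by simp
      then show ?thesis
        by (simp add: h_def q_def inner_eq_Re_cinner complex_nonneg_Reals_iff)
    qed
    then show "positive_op (Delta_op T)" using Delta_iff by blast
  next
    assume "positive_op (Delta_op T)"
    then show "positive_definite T"
      unfolding positive_definite_def sum_support_eq_cinner_Delta_op[OF assms(1,2) T3]
      by (auto simp: neg positive_op_def)
  qed
  have contr: "contraction T1" if nonneg: "\<And>x0 x1 x2 x3. 0 \<le> q x0 x1 x2 x3"
  proof -
    have "norm (T1 y) \<le> norm y" for y
    proof -
      \<comment> \<open>For fixed second entry \<open>y\<close>, the form of \<open>M\<close> is
        minimal at first entry \<open>- T1 y\<close>.\<close>
      have "0 \<le> inner (M (- T1 y, y)) (- T1 y, y)"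
        using nonneg[of "- T1 y" y 0 0] by (simp add: q_pairs linear_0[OF bounded_clinear_linear[OF bcl'(1)]] zero_prod_def[symmetric] )
      also have "\<dots> = (norm y)\<^sup>2 - (norm (T1 y))\<^sup>2"
        by (simp add: M_def block_op_def inner_prod_def inner_add_left inner_diff_left adj' power2_norm_eq_inner
            linear_neg[OF lin(2)])
      finally have "(norm (T1 y))\<^sup>2 \<le> (norm y)\<^sup>2" by linarith
      then show ?thesis by (rule power2_le_imp_le) (rule norm_ge_zero)
    qed
    then show ?thesis using bcl(1) by (simp add: contraction_iff)
  qed

  \<comment> \<open>Equivalence with (3): factorization through the root of \<open>M\<close>\<close>
  define S where "S = half_op T1"
  define S' where "S' = cadjoint S"
  define D where "D = defect S"
  define D' where "D' = defect S'"
  have three: "(\<forall>x0 x1 x2 x3. 0 \<le> q x0 x1 x2 x3) \<longleftrightarrow> contraction T1 \<and>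
      (\<exists>G1 G2 G4. bounded_clinear G1 \<and> bounded_clinear G2 \<and> bounded_clinear G4 \<and>
        contraction (block_op G1 G2 (cadjoint G2) G4) \<and>
        cadjoint (block_op G1 G2 (cadjoint G2) G4) = block_op G1 G2 (cadjoint G2) G4 \<and>
        (\<forall>x. T2 x = D' (G1 (D' x)) + D' (G2 (S' x)) + S (cadjoint G2 (D' x)) + S (G4 (S' x))) \<and>
        (\<forall>x. T2 x = S' (G1 (S x)) + S' (G2 (D x)) + D (cadjoint G2 (S x)) + D (G4 (D x))) \<and>
        (\<forall>x. T1 x = S' (G1 (D' x)) + S' (G2 (S' x)) + D (cadjoint G2 (D' x)) + D (G4 (S' x))))"
    (is "?nonneg \<longleftrightarrow> contraction T1 \<and> ?three")
  \<comment> \<open>Only for a contraction is \<open>M\<close> positive, with the expected block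
    root; otherwise both sides fail, the left one by \<open>contr\<close>.\<close>
  proof (cases "contraction T1")
    case True
    define R where "R = op_sqrt M"
    have M: "positive_op M"
      unfolding M_def T1'_def by (rule positive_op_block_contraction[OF True])
    have R: "R = block_op D' S S' D" and bclR: "bounded_clinear D'" "bounded_clinear S"
        "bounded_clinear S'" "bounded_clinear D"
      using op_sqrt_block_contraction[OF True]
      by (simp_all add: R_def M_def T1'_def S_def S'_def D_def D'_def bounded_clinear_cadjoint)
    have psdR: "psd R" and RR: "\<And>z. R (R z) = M z"
      using positive_op_sqrt[OF M] op_sqrt_op_sqrt[OF M] by (simp_all add: R_def positive_op_iff_psd)
    note linR = bclR[THEN bounded_clinear_linear]
    note R0 = linR[THEN linear_0] and Radd = linR[THEN linear_add]
    have B_sa: "inner (B x) y = inner x (B y)" for x y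
      by (cases x; cases y)
        (simp add: B_def block_op_def inner_prod_def inner_add_left inner_add_right move)
    have nonneg_iff: "?nonneg \<longleftrightarrow> (\<forall>u v. 0 \<le> inner (M u) u + inner (M v) v + 2 * inner (B v) u)"
      by (simp add: q_pairs)
    have "?nonneg \<longleftrightarrow> ?three"
    proof
      assume ?nonneg
      then have *: "0 \<le> inner (M u) u + inner (M v) v + 2 * inner (B v) u" for u v
        using nonneg_iff by blast
      obtain G where G: "contraction G" "\<And>x y. inner (G x) y = inner x (G y)"
          "\<And>x. B x = R (G (R x))"
        using block_form_nonneg_imp_selfadjoint_factorization[OF M bcl'(1) B_sa *]
        unfolding R_def by metis
      have bclG: "bounded_clinear G" using G(1) by (simp add: contraction_iff)
      define G1 where "G1 = (\<lambda>x. fst (G (x, 0)))"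
      define G2 where "G2 = (\<lambda>x. fst (G (0, x)))"
      define G4 where "G4 = (\<lambda>x. snd (G (0, x)))"
      note blk = selfadjoint_block_op[OF bclG G(2), folded G1_def G2_def G4_def]
      have G_sa: "cadjoint G = G" by (rule cadjoint_eqI_inner[OF bclG G(2)])
      note 0 = R0 lin[THEN linear_0]
      show ?three
      proof (rule exI[of _ G1], rule exI[of _ G2], rule exI[of _ G4], intro conjI allI)
        fix x
        \<comment> \<open>The two columns of \<open>B = R G R\<close>. Three of their four
          components are the equations of (3).\<close>
        have 1: "R (G (R (x, 0))) = (T2 x, T1 x)" "R (G (R (0, x))) = (T1' x, T2 x)"
          by (simp_all add: G(3)[symmetric] B_def block_op_def 0)
        show "T2 x = D' (G1 (D' x)) + D' (G2 (S' x)) + S (cadjoint G2 (D' x)) + S (G4 (S' x))"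
          and "T1 x = S' (G1 (D' x)) + S' (G2 (S' x)) + D (cadjoint G2 (D' x)) + D (G4 (S' x))"
          using 1(1) unfolding R blk(4) by (simp_all add: block_op_def 0 Radd add.assoc)
        show "T2 x = S' (G1 (S x)) + S' (G2 (D x)) + D (cadjoint G2 (S x)) + D (G4 (D x))"
          using 1(2) unfolding R blk(4) by (simp add: block_op_def 0 Radd add.assoc)
      qed (use blk G(1) G_sa in \<open>simp_all add: blk(4)[symmetric]\<close>)
    next
      assume ?three
      then obtain G1 G2 G4 where G: "bounded_clinear G1" "bounded_clinear G2" "bounded_clinear G4"
        "contraction (block_op G1 G2 (cadjoint G2) G4)"
        "cadjoint (block_op G1 G2 (cadjoint G2) G4) = block_op G1 G2 (cadjoint G2) G4"
        "\<And>x. T2 x = D' (G1 (D' x)) + D' (G2 (S' x)) + S (cadjoint G2 (D' x)) + S (G4 (S' x))"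
        "\<And>x. T2 x = S' (G1 (S x)) + S' (G2 (D x)) + D (cadjoint G2 (S x)) + D (G4 (D x))"
        "\<And>x. T1 x = S' (G1 (D' x)) + S' (G2 (S' x)) + D (cadjoint G2 (D' x)) + D (G4 (S' x))"
        by blast
      define G where "G = block_op G1 G2 (cadjoint G2) G4"
      have bclG: "bounded_clinear G" and G_le: "\<And>x. norm (G x) \<le> norm x"
        using G(4) by (auto simp: contraction_iff G_def)
      have G_sa: "inner (G x) y = inner x (G y)" for x y
        using inner_cadjoint[OF bclG] G(5) by (simp add: G_def)
      note 0 = R0 G(1-3)[THEN bounded_clinear_linear, THEN linear_0]
        bounded_clinear_cadjoint[OF G(2), THEN bounded_clinear_linear, THEN linear_0]
      have 1: "R (G (R (x, 0))) = (T2 x, T1 x)" for x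
        unfolding R G_def by (simp add: block_op_def 0 Radd G(6,8)[of x] add.assoc)
      have 2: "snd (R (G (R (0, x)))) = T2 x" for x
        unfolding R G_def by (simp add: block_op_def 0 Radd G(7)[of x] add.assoc)
      \<comment> \<open>The upper right entry is not among the equations of (3); it follows from the
        lower left one by self-adjointness of \<open>R G R\<close>.\<close>
      have "inner (fst (R (G (R (0, y))))) x = inner (T1' y) x" for x y
      proof -
        have "inner (R (G (R (0, y)))) (x, 0) = inner (0, y) (R (G (R (x, 0))))"
          by (simp add: psd_selfadjoint[OF psdR] G_sa)
        then show ?thesis unfolding 1 by (simp add: inner_prod_def adj')
      qed
      then have 3: "fst (R (G (R (0, y)))) = T1' y" for y by (metis vector_eq_rdot)
      have lins: "linear R" "linear G" using psd_linear[OF psdR] bounded_clinear_linear[OF bclG] .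
      have B_eq: "B z = R (G (R z))" for z
      proof -
        obtain x y where z: "z = (x, y)" by (cases z)
        have "R (G (R (x, y))) = R (G (R (x, 0))) + R (G (R (0, y)))"
          by (simp flip: linear_add[OF lins(1)] linear_add[OF lins(2)])
        then show ?thesis using 2 3 by (simp add: z 1 B_def block_op_def prod_eq_iff)
      qed
      have "inner (B v) u \<le> norm (R v) * norm (R u)" for u v
        using norm_cauchy_schwarz[of "G (R v)" "R u"]
          mult_right_mono[OF G_le[of "R v"] norm_ge_zero[of "R u"]]
        by (simp add: B_eq psd_selfadjoint[OF psdR])
      then show ?nonneg
        using nonneg_iff block_form_nonneg_iff[OF psdR RR bounded_clinear_linear[OF bcl'(1)]] by blast
    qed
    with True show ?thesis by simp
  qed (use contr in blast)

  \<comment> \<open>Equivalence with (4): factorizations on the even and odd parts\<close>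
  have parity_iff: "(\<forall>x0 x1 x2 x3. 0 \<le> q x0 x1 x2 x3) \<longleftrightarrow>
      (\<forall>u v. 0 \<le> inner (E u) u + inner (E v) v + 2 * inner (X v) u) \<and>
      (\<forall>u v. 0 \<le> inner (F u) u + inner (F v) v + 2 * inner (Y v) u)"
    (is "?nonneg \<longleftrightarrow> ?even \<and> ?odd")
  proof
    assume ?nonneg
    have "0 \<le> inner (E u) u + inner (E v) v + 2 * inner (X v) u"
      "0 \<le> inner (F u) u + inner (F v) v + 2 * inner (Y v) u" for u v
    proof -
      note 0 = bcl'[THEN bounded_clinear_linear, THEN linear_0]
      have half: "(1/2) *\<^sub>R w + (1/2) *\<^sub>R w = w" for w :: 'a
        by (simp flip: scaleR_left_distrib)
      \<comment> \<open>Taking \<open>x0 = x2 = u / 2\<close> and \<open>x1 = x3 = v / 2\<close>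
        kills the differences and isolates the even form; opposite signs below isolate the odd
        one.\<close>
      show "0 \<le> inner (E u) u + inner (E v) v + 2 * inner (X v) u"
        using \<open>?nonneg\<close>[rule_format, of "(1/2) *\<^sub>R u" "(1/2) *\<^sub>R v" "(1/2) *\<^sub>R u" "(1/2) *\<^sub>R v"]
          q_parity[of "(1/2) *\<^sub>R u" "(1/2) *\<^sub>R v" "(1/2) *\<^sub>R u" "(1/2) *\<^sub>R v"]
        by (simp add: half 0)
      show "0 \<le> inner (F u) u + inner (F v) v + 2 * inner (Y v) u"
        using \<open>?nonneg\<close>[rule_format, of "(1/2) *\<^sub>R u" "(1/2) *\<^sub>R v" "- ((1/2) *\<^sub>R u)" "- ((1/2) *\<^sub>R v)"]
          q_parity[of "(1/2) *\<^sub>R u" "(1/2) *\<^sub>R v" "- ((1/2) *\<^sub>R u)" "- ((1/2) *\<^sub>R v)"]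
        by (simp add: half 0)
    qed
    then show "?even \<and> ?odd" by blast
  next
    assume *: "?even \<and> ?odd"
    have "0 \<le> 2 * q x0 x1 x2 x3" for x0 x1 x2 x3
      unfolding q_parity using * by (intro add_nonneg_nonneg[of "_ + _ + _" "_ + _ + _"]) blast+
    then show ?nonneg by simp
  qed
  have four: "(\<forall>x0 x1 x2 x3. 0 \<le> q x0 x1 x2 x3) \<longleftrightarrow> contraction T1 \<and> positive_op F \<and> positive_op E \<and>
      (\<exists>Gp Gm. contraction_on (closure (range E)) Gp \<and> contraction_on (closure (range F)) Gm \<and>
        (\<forall>x. X x = op_sqrt E (Gp (op_sqrt E x))) \<and> (\<forall>x. Y x = op_sqrt F (Gm (op_sqrt F x))))"
    (is "?nonneg \<longleftrightarrow> _ \<and> _ \<and> _ \<and> ?four")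
  proof (cases "positive_op E \<and> positive_op F")
    case True
    then have "?nonneg \<longleftrightarrow> ?four"
      unfolding parity_iff
      using block_form_nonneg_iff_factorization[of E X] block_form_nonneg_iff_factorization[of F Y]
        bcl'(5,6) by blast
    with True contr show ?thesis by blast
  next
    case False
    \<comment> \<open>Positivity of the diagonal entries is forced by the block forms at
      \<open>v = 0\<close>, so both sides fail in this case.\<close>
    have "positive_op E \<and> positive_op F" if ?nonneg
    proof -
      have "0 \<le> inner (E u) u" "0 \<le> inner (F u) u" for u
        using that[unfolded parity_iff, THEN conjunct1, rule_format, of u 0]
          that[unfolded parity_iff, THEN conjunct2, rule_format, of u 0]
          bcl'[THEN bounded_clinear_linear, THEN linear_0] by simp_all
      moreover have "inner (E u) v = inner u (E v)" "inner (F u) v = inner u (F v)" for u v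
        by (simp_all add: E_def F_def inner_simps sa)
      ultimately show ?thesis
        using bcl' by (simp add: positive_op_iff_psd psd_def bounded_clinear_bounded_linear)
    qed
    with False show ?thesis by blast
  qed
  have "positive_definite T \<longleftrightarrow> (\<forall>x0 x1 x2 x3. 0 \<le> q x0 x1 x2 x3)"
    using pd Delta_iff by blast
  note iff3 = this[unfolded three] and iff4 = this[unfolded four]
  show ?thesis
    using pd iff3 iff4
    unfolding Let_def S_def D_def D'_def S'_def E_def[abs_def] F_def[abs_def] X_def Y_def
      T1'_def T1_def T2_def
    by (intro conjI)
qed

end
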